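(* Let $r\ge1$ and let $f_1,\ldots,f_r:\mathbb{Z}\to\mathbb{C}^*$ be group homomorphisms such that the partial products $g_i := \prod_{1\le j\le i} f_j$ satisfy $|g_i(1)|\le1$ for all $1\le i\le r$. Consider the meromorphic continuation to $\mathbb{C}^r$ of $L_r(f_1,\ldots,f_r;\ s_1,\ldots,s_r)$. (a) If $g_i(1)\neq 1$ for all $1\le i\le r$, then $L_r(f_1,\ldots,f_r;\ s_1,\ldots,s_r)$ is holomorphic on $\mathbb{C}^r$. Otherwise, let $i_1<\cdots<i_m$ be all the indices $i\in\{1,\ldots,r\}$ with $g_i(1)=1$. (b) If $i_1=1$, then $L_r(f_1,\ldots,f_r;\ s_1,\ldots,s_r)$ is holomorphic outside the union of the hyperplanes $$s_1=1;\qquad s_1+\cdots+s_{i_j}=n \text{ for all } n\in\mathbb{Z}_{\le j} \text{ and } 2\le j\le m,$$ and has at most simple poles along each of these hyperplanes. (c) If $i_1\neq1$, then $L_r(f_1,\ldots,f_r;\ s_1,\ldots,s_r)$ is holomorphic outside the union of the hyperplanes $$s_1+\cdots+s_{i_j}=n \text{ for all } n\in\mathbb{Z}_{\le j} \text{ and } 1\le j\le m,$$ and has at most simple poles along each of these hyperplanes.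
   Context: The multiple additive $L$-function is defined on $U_r := \{ (s_1,\ldots,s_r) : \Re(s_1+\cdots+s_i) > i \ \forall i\}$ by $$L_r(f_1,\ldots,f_r;\ s_1,\ldots,s_r) := \sum_{n_1>\cdots>n_r>0} \frac{f_1(n_1)\cdots f_r(n_r)}{n_1^{s_1}\cdots n_r^{s_r}}$$ and extends meromorphically to $\mathbb{C}^r$ (for $r=1$ with $f_1(1)=1$ this is the Riemann zeta function; for $r=1$ with $f_1(1)\neq1$ it is entire). $\mathbb{Z}_{\le j}$ denotes the set of integers $\le j$. *)

theory Defs
  imports "HOL-Complex_Analysis.Complex_Analysis"
begin

text \<open>
  Points of \<open>\<complex>\<^sup>r\<close> are functions on the index set \<open>{1..r}\<close>, extended by \<open>undefined\<close>,
  so that the dimension can be a variable of type \<^typ>\<open>nat\<close>.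
\<close>

definition Cn :: "nat \<Rightarrow> (nat \<Rightarrow> complex) topology" where
  "Cn r = product_topology (\<lambda>_. euclidean) {1..r}"

abbreviation Cspace :: "nat \<Rightarrow> (nat \<Rightarrow> complex) set" where
  "Cspace r \<equiv> topspace (Cn r)"

text \<open>
  Holomorphy in several variables on an open set: continuity together with holomorphy in
  each variable separately.
\<close>

definition holomorphic_Cn :: "nat \<Rightarrow> (nat \<Rightarrow> complex) set \<Rightarrow> ((nat \<Rightarrow> complex) \<Rightarrow> complex) \<Rightarrow> bool"
  where
  "holomorphic_Cn r U F \<longleftrightarrow>
     openin (Cn r) U \<and>
     continuous_map (subtopology (Cn r) U) euclidean F \<and>
     (\<forall>s\<in>U. \<forall>i\<in>{1..r}. (\<lambda>z. F (s(i := z))) holomorphic_on {z. s(i := z) \<in> U})"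

text \<open>\<open>P\<close> holds on an open dense subset of \<open>W\<close>.\<close>

definition generically :: "nat \<Rightarrow> (nat \<Rightarrow> complex) set \<Rightarrow> ((nat \<Rightarrow> complex) \<Rightarrow> bool) \<Rightarrow> bool"
  where
  "generically r W P \<longleftrightarrow>
     (\<exists>D. openin (Cn r) D \<and> D \<subseteq> W \<and> W \<subseteq> Cn r closure_of D \<and> (\<forall>s\<in>D. P s))"

text \<open>
  A meromorphic function is locally a quotient of holomorphic functions whose denominator is
  not a zero divisor.  It is represented by a total function whose values on a nowhere dense
  closed set (poles, points of indeterminacy, unremoved removable singularities) are
  irrelevant.
\<close>

definition meromorphic_Cn :: "nat \<Rightarrow> ((nat \<Rightarrow> complex) \<Rightarrow> complex) \<Rightarrow> bool" where
  "meromorphic_Cn r F \<longleftrightarrow>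
     (\<forall>p\<in>Cspace r. \<exists>V g h. p \<in> V \<and> holomorphic_Cn r V g \<and> holomorphic_Cn r V h \<and>
        generically r V (\<lambda>s. h s \<noteq> 0 \<and> F s = g s / h s))"

text \<open>
  Holomorphy on \<open>W\<close> of the meromorphic function represented by \<open>F\<close>, that is, after filling
  in removable singularities.
\<close>

definition mero_holomorphic_on ::
  "nat \<Rightarrow> ((nat \<Rightarrow> complex) \<Rightarrow> complex) \<Rightarrow> (nat \<Rightarrow> complex) set \<Rightarrow> bool" where
  "mero_holomorphic_on r F W \<longleftrightarrow>
     (\<exists>G. holomorphic_Cn r W G \<and> generically r W (\<lambda>s. F s = G s))"

text \<open>The affine form \<open>s\<^sub>1 + \<dots> + s\<^sub>i - n\<close> and the hyperplane it defines.\<close>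

definition partial_sum_form :: "nat \<Rightarrow> int \<Rightarrow> (nat \<Rightarrow> complex) \<Rightarrow> complex" where
  "partial_sum_form i n s = (\<Sum>j=1..i. s j) - of_int n"

definition hyperplane :: "nat \<Rightarrow> nat \<Rightarrow> int \<Rightarrow> (nat \<Rightarrow> complex) set" where
  "hyperplane r i n = {s \<in> Cspace r. partial_sum_form i n s = 0}"

text \<open>
  The order of \<open>F\<close> along the hyperplane is at least \<open>-1\<close>: near each of its points
  \<open>F = g / (l * h)\<close>, where \<open>l\<close> is the affine form and \<open>h\<close> does not vanish identically on any
  open piece of the hyperplane.  The factor \<open>h\<close> accounts for other polar hyperplanes passing
  through the same point.
\<close>

definition at_most_simple_pole_along ::
  "nat \<Rightarrow> ((nat \<Rightarrow> complex) \<Rightarrow> complex) \<Rightarrow> nat \<Rightarrow> int \<Rightarrow> bool" where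
  "at_most_simple_pole_along r F i n \<longleftrightarrow>
     (\<forall>p\<in>hyperplane r i n. \<exists>V g h. p \<in> V \<and> holomorphic_Cn r V g \<and> holomorphic_Cn r V h \<and>
        V \<inter> hyperplane r i n \<subseteq> Cn r closure_of {s \<in> V \<inter> hyperplane r i n. h s \<noteq> 0} \<and>
        generically r V (\<lambda>s. partial_sum_form i n s * h s * F s = g s))"

definition holomorphic_with_simple_poles ::
  "nat \<Rightarrow> ((nat \<Rightarrow> complex) \<Rightarrow> complex) \<Rightarrow> (nat \<times> int) set \<Rightarrow> bool" where
  "holomorphic_with_simple_poles r F P \<longleftrightarrow>
     mero_holomorphic_on r F (Cspace r - (\<Union>(i, n)\<in>P. hyperplane r i n)) \<and>
     (\<forall>(i, n)\<in>P. at_most_simple_pole_along r F i n)"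

definition U_dom :: "nat \<Rightarrow> (nat \<Rightarrow> complex) set" where
  "U_dom r = {s \<in> Cspace r. \<forall>i\<in>{1..r}. Re (\<Sum>j=1..i. s j) > real i}"

text \<open>Strictly decreasing tuples \<open>n\<^sub>1 > \<dots> > n\<^sub>r > 0\<close>.\<close>

definition decr_tuples :: "nat \<Rightarrow> (nat \<Rightarrow> nat) set" where
  "decr_tuples r = {n \<in> {1..r} \<rightarrow>\<^sub>E {1..}. \<forall>i\<in>{1..<r}. n (Suc i) < n i}"

text \<open>
  The sum is unconditional.  On \<^term>\<open>U_dom r\<close> the series converges absolutely when the
  \<open>f\<^sub>i\<close> are homomorphisms whose partial products \<open>g\<^sub>i\<close> satisfy \<open>\<bar>g\<^sub>i(1)\<bar> \<le> 1\<close>, since then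
  the absolute value of \<open>f\<^sub>1(n\<^sub>1) \<dots> f\<^sub>r(n\<^sub>r)\<close> is at most \<open>1\<close>.
\<close>

definition mult_L :: "nat \<Rightarrow> (nat \<Rightarrow> int \<Rightarrow> complex) \<Rightarrow> (nat \<Rightarrow> complex) \<Rightarrow> complex" where
  "mult_L r f s =
     (\<Sum>\<^sub>\<infinity>n\<in>decr_tuples r. \<Prod>i=1..r. f i (int (n i)) / of_nat (n i) powr s i)"

definition meromorphic_continuation ::
  "nat \<Rightarrow> (nat \<Rightarrow> int \<Rightarrow> complex) \<Rightarrow> ((nat \<Rightarrow> complex) \<Rightarrow> complex) \<Rightarrow> bool" where
  "meromorphic_continuation r f F \<longleftrightarrow>
     meromorphic_Cn r F \<and> (\<forall>s\<in>U_dom r. F s = mult_L r f s)"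

definition char_hom :: "(int \<Rightarrow> complex) \<Rightarrow> bool" where
  "char_hom u \<longleftrightarrow> (\<forall>m. u m \<noteq> 0) \<and> (\<forall>m n. u (m + n) = u m * u n)"

definition partial_prod :: "(nat \<Rightarrow> int \<Rightarrow> complex) \<Rightarrow> nat \<Rightarrow> int \<Rightarrow> complex" where
  "partial_prod f i n = (\<Prod>j=1..i. f j n)"

end

theory Submission
  imports Defs
begin

text \<open>
  Put \<open>\<sigma>\<^sub>i = s\<^sub>1 + \<dots> + s\<^sub>i\<close>.  Summing \<open>a\<^sup>m\<^sup>-\<^sup>1(m - 1)\<^sup>-\<^sup>u - a\<^sup>m m\<^sup>-\<^sup>u\<close> over \<open>m > n\<^sub>2\<close>, with \<open>a = f\<^sub>1(1)\<close> and
  \<open>u = s\<^sub>1 - 1\<close> if \<open>a = 1\<close>, \<open>u = s\<^sub>1\<close> otherwise, telescopes to \<open>a\<^bsup>n\<^sub>2\<^esup> n\<^sub>2\<^sup>-\<^sup>u\<close> and so merges the first two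
  variables; expanding \<open>(m - 1)\<^sup>-\<^sup>u\<close> binomially expresses the same sum by the original series and its
  translates \<open>s\<^sub>1 + k\<close>, up to a remainder that converges on an arbitrarily large domain.  This continues
  the series to the left, by induction on the depth and on the size of the domain.

  Multiplying by \<open>s\<^sub>1 - 1\<close> (if \<open>g\<^sub>1(1) = 1\<close>) and by \<open>1/\<Gamma>(\<sigma>\<^sub>i - d\<^sub>i)\<close> for every \<open>i \<ge> 2\<close> with \<open>g\<^sub>i(1) = 1\<close>, where \<open>d\<^sub>i\<close> is
  the number of \<open>j \<le> i\<close> with \<open>g\<^sub>j(1) = 1\<close>, clears all denominators: these factors are preserved by the merging, and
  a translation changes them by a polynomial only.  The continuation is thus an entire function divided
  by a product whose zeros are exactly the listed hyperplanes, all of them simple.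
\<close>

section \<open>Separately holomorphic functions of a sequence\<close>

text \<open>The choice of \<open>u\<close> is dictated by the lowest-order term. Multiplied by
  \<open>a\<close> and expanded, the telescoping difference begins, apart from \<open>a^m\<close>,
  with \<open>(1 - a) m^(-u)\<close>, which yields the series itself for \<open>u = s_1\<close> if
  \<open>a\<close> is not 1. For \<open>a = 1\<close> this term vanishes and the next one,
  \<open>u m^(-u-1)\<close>, has to do so; this forces \<open>u = s_1 - 1\<close> and creates the
  pole at \<open>s_1 = 1\<close>. The recursion divides by this coefficient at every stage, and the
  translates bring poles of their own. Multiplying the series beforehand by one fixed function keeps
  the whole induction among holomorphic functions, without arithmetic of meromorphic functions of
  several variables. The reciprocal Gamma function suits both operations: \<open>1/Gamma(z)\<close>
  is a polynomial multiple of \<open>1/Gamma(z + k)\<close>, and merging lowers the partial sum and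
  the count by the same amount. In the first variable a linear factor suffices, because for
  \<open>a = 1\<close> the coefficient of the translate by \<open>k\<close> contains
  \<open>s_1 - 1 + k\<close>, which cancels the pole of that translate. The theorem speaks of every
  function that represents the continuation, so an identity theorem is needed besides
  existence.\<close>

text \<open>
  Inside the proof, points are total sequences indexed from \<open>0\<close>, so that the depth does not occur in
  the type of the domain; only finitely many entries matter.
\<close>

definition separately_holo :: "(nat \<Rightarrow> complex) set \<Rightarrow> ((nat \<Rightarrow> complex) \<Rightarrow> complex) \<Rightarrow> bool" where
  "separately_holo W F \<longleftrightarrow> continuous_on W F \<and>
     (\<forall>s\<in>W. \<forall>i. (\<lambda>z. F (s(i := z))) holomorphic_on {z. s(i := z) \<in> W})"

lemma separately_holo_subset:
  "separately_holo W F \<Longrightarrow> W' \<subseteq> W \<Longrightarrow> separately_holo W' F"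
  unfolding separately_holo_def
  by (blast intro: continuous_on_subset holomorphic_on_subset)

lemma separately_holo_cong:
  assumes "separately_holo W F" "\<And>s. s \<in> W \<Longrightarrow> F s = G s"
  shows "separately_holo W G"
proof -
  have "(\<lambda>z. G (s(i := z))) holomorphic_on {z. s(i := z) \<in> W}" if "s \<in> W" for s i
    by (rule holomorphic_transform[of "\<lambda>z. F (s(i := z))"])
       (use assms that in \<open>auto simp: separately_holo_def\<close>)
  moreover have "continuous_on W G"
    using assms continuous_on_cong[of W W F G] unfolding separately_holo_def by simp
  ultimately show ?thesis unfolding separately_holo_def by blast
qed

lemma continuous_on_coordinate: "continuous_on W (\<lambda>s. s i)"
  by (rule continuous_on_subset[OF continuous_on_product_coordinates]) simp

lemma separately_holo_const: "separately_holo W (\<lambda>s. c)"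
  unfolding separately_holo_def by auto

lemma separately_holo_coord: "separately_holo W (\<lambda>s. s i)"
proof -
  have "(\<lambda>z. (s(j := z)) i) holomorphic_on A" for s j A
    by (cases "i = j") (auto intro!: holomorphic_intros)
  thus ?thesis unfolding separately_holo_def by (auto intro!: continuous_on_coordinate simp del: fun_upd_apply)
qed

lemma separately_holo_add:
  "separately_holo W F \<Longrightarrow> separately_holo W G \<Longrightarrow> separately_holo W (\<lambda>s. F s + G s)"
  unfolding separately_holo_def by (auto intro!: continuous_intros holomorphic_intros)

lemma separately_holo_diff:
  "separately_holo W F \<Longrightarrow> separately_holo W G \<Longrightarrow> separately_holo W (\<lambda>s. F s - G s)"
  unfolding separately_holo_def by (auto intro!: continuous_intros holomorphic_intros)

lemma separately_holo_mult:
  "separately_holo W F \<Longrightarrow> separately_holo W G \<Longrightarrow> separately_holo W (\<lambda>s. F s * G s)"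
  unfolding separately_holo_def by (auto intro!: continuous_intros holomorphic_intros)

lemma separately_holo_sum:
  "(\<And>x. x \<in> I \<Longrightarrow> separately_holo W (F x)) \<Longrightarrow> separately_holo W (\<lambda>s. \<Sum>x\<in>I. F x s)"
  by (induction I rule: infinite_finite_induct)
     (auto intro: separately_holo_const separately_holo_add)

lemma separately_holo_prod:
  "(\<And>x. x \<in> I \<Longrightarrow> separately_holo W (F x)) \<Longrightarrow> separately_holo W (\<lambda>s. \<Prod>x\<in>I. F x s)"
  by (induction I rule: infinite_finite_induct)
     (auto intro: separately_holo_const separately_holo_mult)

lemma separately_holo_entire:
  assumes "separately_holo W F" "h holomorphic_on UNIV"
  shows "separately_holo W (\<lambda>s. h (F s))"
  using assms unfolding separately_holo_def
  by (auto intro!: continuous_on_compose2[of UNIV h] holomorphic_on_imp_continuous_on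
      holomorphic_on_compose_gen[of _ _ h UNIV, unfolded o_def])

lemmas separately_holo_intros =
  separately_holo_const separately_holo_coord separately_holo_add separately_holo_diff
  separately_holo_mult separately_holo_sum separately_holo_prod

text \<open>Moving one coordinate of the source moves a single coordinate of the image, by a
  translation, so slices pull back to translated slices. Translating the first variable and merging
  the first two are both of this kind.\<close>

lemma separately_holo_pullback:
  assumes F: "separately_holo W' F" and cont: "continuous_on UNIV \<phi>"
    and sub: "\<And>s. s \<in> W \<Longrightarrow> \<phi> s \<in> W'"
    and upd: "\<And>s i. \<exists>i' c. \<forall>z. \<phi> (s(i := z)) = (\<phi> s)(i' := c + z)"
  shows "separately_holo W (\<lambda>s. F (\<phi> s))"
  unfolding separately_holo_def
proof (intro conjI ballI allI)
  show "continuous_on W (\<lambda>s. F (\<phi> s))"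
    using F cont sub unfolding separately_holo_def
    by (blast intro: continuous_on_compose2[of W' F] continuous_on_subset)
  fix s i assume s: "s \<in> W"
  obtain i' c where u: "\<And>z. \<phi> (s(i := z)) = (\<phi> s)(i' := c + z)" using upd by blast
  have "(\<lambda>z. F ((\<phi> s)(i' := z))) holomorphic_on {z. (\<phi> s)(i' := z) \<in> W'}"
    using F sub[OF s] unfolding separately_holo_def by blast
  hence "(\<lambda>z. F ((\<phi> s)(i' := c + z))) holomorphic_on {z. s(i := z) \<in> W}"
    by (intro holomorphic_on_compose_gen[of "\<lambda>z. c + z" _ "\<lambda>z. F ((\<phi> s)(i' := z))", unfolded o_def])
       (use u sub in \<open>fastforce intro!: holomorphic_intros\<close>)+
  thus "(\<lambda>z. F (\<phi> (s(i := z)))) holomorphic_on {z. s(i := z) \<in> W}" by (simp add: u)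
qed

lemma continuous_on_fun_upd: "continuous_on A (\<lambda>z. (s::nat \<Rightarrow> complex)(i := z))"
proof (rule continuous_on_coordinatewise_then_product)
  show "continuous_on A (\<lambda>z. (s(i := z)) j)" for j
    by (cases "j = i") (auto intro!: continuous_intros)
qed

lemma open_slice: "open W \<Longrightarrow> open {z. (s::nat \<Rightarrow> complex)(i := z) \<in> W}"
  using open_vimage[OF _ continuous_on_fun_upd[of UNIV s i], of W]
  by (simp add: vimage_def)

text \<open>The local majorants make the finite partial sums converge locally uniformly along the
  filter of finite subsets. Continuity passes to the limit directly, holomorphy by restricting to a
  closed disc in a slice.\<close>

lemma separately_holo_infsum:
  fixes f :: "'x \<Rightarrow> (nat \<Rightarrow> complex) \<Rightarrow> complex"
  assumes W: "open W" and f: "\<And>x. x \<in> D \<Longrightarrow> separately_holo W (f x)"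
    and dom: "\<And>p. p \<in> W \<Longrightarrow> \<exists>V M. open V \<and> p \<in> V \<and> V \<subseteq> W \<and> M summable_on D \<and>
                (\<forall>x\<in>D. \<forall>s\<in>V. norm (f x s) \<le> M x)"
  shows "separately_holo W (\<lambda>s. \<Sum>\<^sub>\<infinity>x\<in>D. f x s)"
proof -
  let ?g = "\<lambda>s. \<Sum>\<^sub>\<infinity>x\<in>D. f x s" and ?Fl = "finite_subsets_at_top D"
  have fin: "separately_holo W (\<lambda>s. \<Sum>x\<in>X. f x s)" if "X \<subseteq> D" for X
    using f that by (intro separately_holo_sum) auto
  have ev: "\<forall>\<^sub>F X in ?Fl. P X" if "\<And>X. X \<subseteq> D \<Longrightarrow> P X" for P
    using that unfolding eventually_finite_subsets_at_top by (intro exI[of _ "{}"]) auto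
  have loc: "\<exists>V. open V \<and> p \<in> V \<and> V \<subseteq> W \<and> uniform_limit V (\<lambda>X s. \<Sum>x\<in>X. f x s) ?g ?Fl"
    if p: "p \<in> W" for p
  proof -
    obtain V M where V: "open V" "p \<in> V" "V \<subseteq> W" "M summable_on D"
      "\<And>x s. x \<in> D \<Longrightarrow> s \<in> V \<Longrightarrow> norm (f x s) \<le> M x" using dom[OF p] by blast
    have "uniform_limit V (\<lambda>X s. \<Sum>x\<in>X. f x s) ?g ?Fl"
      by (rule Weierstrass_m_test_general[OF V(5,4)])
    with V show ?thesis by blast
  qed
  show ?thesis unfolding separately_holo_def
  proof (intro conjI ballI allI)
    show "continuous_on W ?g"
    proof (subst continuous_on_eq_continuous_at[OF W], intro ballI)
      fix p assume "p \<in> W"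
      then obtain V where V: "open V" "p \<in> V" "V \<subseteq> W"
        "uniform_limit V (\<lambda>X s. \<Sum>x\<in>X. f x s) ?g ?Fl" using loc by blast
      have "continuous_on V ?g"
        by (rule uniform_limit_theorem[OF ev V(4)])
           (use fin separately_holo_subset[OF _ V(3)] in \<open>auto simp: separately_holo_def\<close>)
      thus "isCont ?g p" using V continuous_on_eq_continuous_at by blast
    qed
    fix s i assume s: "s \<in> W"
    have op: "open {z. s(i := z) \<in> W}" by (rule open_slice[OF W])
    show "(\<lambda>z. ?g (s(i := z))) holomorphic_on {z. s(i := z) \<in> W}"
    proof (subst holomorphic_on_open[OF op], intro ballI)
      fix z assume "z \<in> {z. s(i := z) \<in> W}"
      then obtain V where V: "open V" "s(i := z) \<in> V" "V \<subseteq> W"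
        "uniform_limit V (\<lambda>X s. \<Sum>x\<in>X. f x s) ?g ?Fl" using loc[of "s(i := z)"] by blast
      obtain e where e: "e > 0" "cball z e \<subseteq> {z. s(i := z) \<in> V}"
        using open_slice[OF V(1), of s i] V(2) open_contains_cball by blast
      have h: "(\<lambda>z. \<Sum>x\<in>X. f x (s(i := z))) holomorphic_on cball z e" if "X \<subseteq> D" for X
      proof -
        have "(\<lambda>z. \<Sum>x\<in>X. f x (s(i := z))) holomorphic_on {z. s(i := z) \<in> W}"
          using fin[OF that] s unfolding separately_holo_def by blast
        thus ?thesis using e(2) V(3) by (auto elim!: holomorphic_on_subset)
      qed
      have ul: "uniform_limit (cball z e) (\<lambda>X z. \<Sum>x\<in>X. f x (s(i := z))) (\<lambda>z. ?g (s(i := z))) ?Fl"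
        by (rule uniform_limit_compose'[OF V(4)]) (use e in auto)
      have "(\<lambda>z. ?g (s(i := z))) holomorphic_on ball z e"
        by (rule holomorphic_uniform_limit[OF _ ul])
           (auto intro!: ev h holomorphic_on_imp_continuous_on intro: holomorphic_on_subset[OF h])
      thus "\<exists>f'. ((\<lambda>z. ?g (s(i := z))) has_field_derivative f') (at z)"
        using e(1) by (meson centre_in_ball holomorphic_on_open open_ball)
    qed
  qed
qed

section \<open>Tails of the multiple series\<close>

text \<open>
  Tuples \<open>n\<^sub>1 > \<dots> > n\<^sub>r > 1\<close>, continued by \<open>1\<close>.  The term has one more factor than the tuple, the one of
  \<open>n\<^sub>r\<^sub>+\<^sub>1 = 1\<close>: with it, merging the first two variables needs no special case at \<open>r = 1\<close>.
\<close>

definition desc_tails :: "nat \<Rightarrow> (nat \<Rightarrow> nat) set" where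
  "desc_tails r = {n. (\<forall>i<r. n (Suc i) < n i) \<and> (\<forall>i\<ge>r. n i = 1)}"

definition tail_term :: "nat \<Rightarrow> (nat \<Rightarrow> complex) \<Rightarrow> (nat \<Rightarrow> complex) \<Rightarrow> (nat \<Rightarrow> nat) \<Rightarrow> complex" where
  "tail_term r a s n = (\<Prod>i\<le>r. a i ^ n i * of_nat (n i) powr (- s i))"

definition tail_L :: "nat \<Rightarrow> (nat \<Rightarrow> complex) \<Rightarrow> (nat \<Rightarrow> complex) \<Rightarrow> complex" where
  "tail_L r a s = (\<Sum>\<^sub>\<infinity>n\<in>desc_tails r. tail_term r a s n)"

text \<open>\<open>N = 0\<close> is the domain of convergence, and \<open>N\<close> measures how far
  the continuation reaches to the left. All boundaries move by the same amount because a translation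
  of the first variable changes every partial sum equally.\<close>

definition half_dom :: "nat \<Rightarrow> real \<Rightarrow> (nat \<Rightarrow> complex) set" where
  "half_dom r N = {s. \<forall>i<r. real i + 1 - N < Re (\<Sum>j\<le>i. s j)}"

definition merge_base :: "(nat \<Rightarrow> complex) \<Rightarrow> nat \<Rightarrow> complex" where
  "merge_base a = (\<lambda>i. if i = 0 then a 0 * a 1 else a (Suc i))"

text \<open>The constant \<open>c\<close> is the exponent lost in a merge: 0 or 1 in the recursion,
  a real number in the norm estimate.\<close>

definition merge_arg :: "complex \<Rightarrow> (nat \<Rightarrow> complex) \<Rightarrow> nat \<Rightarrow> complex" where
  "merge_arg c s = (\<lambda>i. if i = 0 then s 0 + s 1 - c else s (Suc i))"

lemma desc_tails_ge1: "n \<in> desc_tails r \<Longrightarrow> n i \<ge> 1"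
  unfolding desc_tails_def by (cases "i < r") (auto simp: Suc_le_eq dest!: spec[of _ i])

lemma desc_tails_ge2: "n \<in> desc_tails r \<Longrightarrow> i < r \<Longrightarrow> n i \<ge> 2"
  using desc_tails_ge1[of n r "Suc i"] unfolding desc_tails_def by fastforce

lemma desc_tails_0: "desc_tails 0 = {\<lambda>_. 1}"
  unfolding desc_tails_def by auto

lemma desc_tails_tl: "n \<in> desc_tails (Suc r) \<Longrightarrow> (\<lambda>i. n (Suc i)) \<in> desc_tails r"
  unfolding desc_tails_def by auto

lemma desc_tails_less: "n \<in> desc_tails (Suc r) \<Longrightarrow> n 1 < n 0"
  unfolding desc_tails_def by auto

lemma desc_tails_Suc:
  "bij_betw (\<lambda>(n, m). case_nat m n) (SIGMA n:desc_tails r. {n 0<..}) (desc_tails (Suc r))"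
  (is "bij_betw ?f ?S _")
proof (rule bij_betw_imageI)
  show "inj_on ?f ?S"
    by (auto simp: inj_on_def fun_eq_iff split: nat.splits)
  show "?f ` ?S = desc_tails (Suc r)"
  proof (intro equalityI subsetI)
    fix n assume "n \<in> ?f ` ?S"
    thus "n \<in> desc_tails (Suc r)" unfolding desc_tails_def by (auto split: nat.splits)
  next
    fix n assume n: "n \<in> desc_tails (Suc r)"
    have "n = ?f (\<lambda>i. n (Suc i), n 0)" by (auto simp: fun_eq_iff split: nat.splits)
    thus "n \<in> ?f ` ?S" using desc_tails_tl[OF n] desc_tails_less[OF n]
      by (intro image_eqI[of _ _ "(\<lambda>i. n (Suc i), n 0)"]) auto
  qed
qed

lemma tail_term_Suc:
  "tail_term (Suc r) a s n = a 0 ^ n 0 * of_nat (n 0) powr (- s 0) *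
     tail_term r (\<lambda>i. a (Suc i)) (\<lambda>i. s (Suc i)) (\<lambda>i. n (Suc i))"
  unfolding tail_term_def by (simp only: prod.atMost_Suc_shift)

text \<open>Here \<open>n 0\<close> is the second index of the longer tuple. Once the first index is
  summed out or estimated, its base and exponent are attached to this index and combine with those
  already there.\<close>

lemma tail_term_merge:
  assumes "n 0 \<ge> 1"
  shows "a 0 ^ n 0 * of_nat (n 0) powr (- (s 0 - c)) *
      tail_term r (\<lambda>i. a (Suc i)) (\<lambda>i. s (Suc i)) n = tail_term r (merge_base a) (merge_arg c s) n"
proof -
  have "of_nat (n 0) powr (c - s 0 - s 1) = (of_nat (n 0) powr (c - s 0) * of_nat (n 0) powr (- s 1) :: complex)"
    by (simp add: powr_add[symmetric])
  thus ?thesis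
    unfolding tail_term_def
    by (simp add: prod.atMost_shift merge_base_def merge_arg_def power_mult_distrib algebra_simps)
qed

text \<open>Merging only removes the first partial product, so the bounds on partial products remain
  available at smaller depth.\<close>

lemma prod_merge_base: "(\<Prod>j\<le>i. merge_base a j) = (\<Prod>j\<le>Suc i. a j)"
  by (induction i) (auto simp: merge_base_def)

lemma sum_merge_arg: "(\<Sum>j\<le>i. merge_arg c s j) = (\<Sum>j\<le>Suc i. s j) - c"
  by (induction i) (auto simp: merge_arg_def)

lemma norm_tail_factor:
  "m \<ge> 1 \<Longrightarrow> norm (a ^ m * of_nat m powr (- s)) = norm a ^ m * real m powr (- Re s)"
  by (simp add: norm_mult norm_power norm_powr_real_powr)

text \<open>
  Merging again: as \<open>n\<^sub>1 > n\<^sub>2\<close>, the factor \<open>\<bar>a\<^sub>1\<bar>\<^bsup>n\<^sub>1\<^esup> n\<^sub>1\<^bsup>-t\<^sub>1\<^esup>\<close> is at most \<open>n\<^sub>1\<^sup>-\<^sup>p\<close> times \<open>\<bar>a\<^sub>1\<bar>\<^bsup>n\<^sub>2\<^esup> n\<^sub>2\<^bsup>-(t\<^sub>1 - p)\<^esup>\<close>.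
\<close>

lemma norm_tail_term:
  assumes "p \<ge> 0" "n \<in> desc_tails r"
    and "\<And>i. i < r \<Longrightarrow> norm (\<Prod>j\<le>i. a j) \<le> 1"
    and "\<And>i. i < r \<Longrightarrow> real (Suc i) * p \<le> Re (\<Sum>j\<le>i. s j)"
  shows "norm (tail_term r a s n) \<le> norm (\<Prod>j\<le>r. a j) * (\<Prod>i<r. real (n i) powr (- p))"
  using assms(2-)
proof (induction r arbitrary: a s n)
  case 0
  thus ?case by (simp add: desc_tails_0 tail_term_def)
next
  case (Suc r)
  define n' where "n' = (\<lambda>i. n (Suc i))"
  have n': "n' \<in> desc_tails r" "1 \<le> n' 0" "n' 0 \<le> n 0"
    using desc_tails_tl[OF Suc.prems(1)] desc_tails_less[OF Suc.prems(1)]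
      desc_tails_ge1[of n' r 0] by (auto simp: n'_def)
  have a0: "norm (a 0) \<le> 1" and s0: "p \<le> Re (s 0)"
    using Suc.prems(2)[of 0] Suc.prems(3)[of 0] by auto
  let ?T = "norm (tail_term r (\<lambda>i. a (Suc i)) (\<lambda>i. s (Suc i)) n')"
  have "norm (tail_term (Suc r) a s n) = norm (a 0) ^ n 0 * real (n 0) powr (- Re (s 0)) * ?T"
    unfolding tail_term_Suc norm_mult[of "_ * _" "tail_term _ _ _ _"] n'_def
    using desc_tails_ge1[OF Suc.prems(1), of 0] by (subst norm_tail_factor) auto
  also have "real (n 0) powr (- Re (s 0)) = real (n 0) powr (- p) * real (n 0) powr (- (Re (s 0) - p))"
    by (simp add: powr_add[symmetric])
  also have "norm (a 0) ^ n 0 * (real (n 0) powr (- p) * real (n 0) powr (- (Re (s 0) - p))) * ?T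
      \<le> norm (a 0) ^ n' 0 * (real (n 0) powr (- p) * real (n' 0) powr (- (Re (s 0) - p))) * ?T"
    using a0 s0 n' assms(1) by (intro mult_mono power_decreasing powr_mono2') auto
  also have "\<dots> = real (n 0) powr (- p) *
      norm (a 0 ^ n' 0 * of_nat (n' 0) powr (- (s 0 - of_real p)) *
        tail_term r (\<lambda>i. a (Suc i)) (\<lambda>i. s (Suc i)) n')"
    unfolding norm_mult[of "_ * _" "tail_term _ _ _ _"] using n' by (subst norm_tail_factor) auto
  also have "\<dots> = real (n 0) powr (- p) * norm (tail_term r (merge_base a) (merge_arg (of_real p) s) n')"
    using n' by (subst tail_term_merge) auto
  also have "\<dots> \<le> real (n 0) powr (- p) *
      (norm (\<Prod>j\<le>r. merge_base a j) * (\<Prod>i<r. real (n' i) powr (- p)))"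
  proof (intro mult_left_mono Suc.IH n'(1))
    show "norm (\<Prod>j\<le>i. merge_base a j) \<le> 1" if "i < r" for i
      using Suc.prems(2)[of "Suc i"] that by (simp only: prod_merge_base)
    show "real (Suc i) * p \<le> Re (\<Sum>j\<le>i. merge_arg (of_real p) s j)" if "i < r" for i
      using Suc.prems(3)[of "Suc i"] that by (simp only: sum_merge_arg) (auto simp: algebra_simps)
  qed auto
  also have "\<dots> = norm (\<Prod>j\<le>Suc r. a j) * (\<Prod>i<Suc r. real (n i) powr (- p))"
    unfolding prod_merge_base prod.lessThan_Suc_shift n'_def by simp
  finally show ?case .
qed

text \<open>Without the constraint that the new first index exceeds the old one, the sum is a
  product of convergent sums; the constrained tuples form a subset of this index set.\<close>

lemma summable_on_prod_powr:
  assumes "p > 1"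
  shows "(\<lambda>n. \<Prod>i<r. real (n i) powr (- p)) summable_on desc_tails r"
proof (induction r)
  case 0
  show ?case by (simp add: desc_tails_0)
next
  case (Suc r)
  have "(\<lambda>m. real m powr (- p)) summable_on UNIV"
    using assms by (intro norm_summable_imp_summable_on) (simp add: summable_real_powr_iff)
  then obtain S where S: "((\<lambda>m. real m powr (- p)) has_sum S) UNIV"
    unfolding summable_on_def by blast
  have "(\<lambda>(n, m). real m powr (- p) * (\<Prod>i<r. real (n i) powr (- p))) summable_on (desc_tails r \<times> UNIV)"
    by (rule summable_on_SigmaI[where g = "\<lambda>n. S * (\<Prod>i<r. real (n i) powr (- p))"])
       (auto intro!: has_sum_cmult_left S summable_on_cmult_right Suc.IH prod_nonneg mult_nonneg_nonneg)
  hence "(\<lambda>(n, m). real m powr (- p) * (\<Prod>i<r. real (n i) powr (- p))) summable_on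
      (SIGMA n:desc_tails r. {n 0<..})"
    by (rule summable_on_subset_banach) auto
  also have "?this \<longleftrightarrow> (\<lambda>x. \<Prod>i<Suc r. real ((case x of (n, m) \<Rightarrow> case_nat m n) i) powr (- p))
      summable_on (SIGMA n:desc_tails r. {n 0<..})"
    by (rule summable_on_cong) (auto simp: prod.lessThan_Suc_shift simp del: prod.lessThan_Suc)
  also have "\<dots> \<longleftrightarrow> ?case"
    by (rule summable_on_reindex_bij_betw[OF desc_tails_Suc])
  finally show ?case .
qed

lemma open_half_dom: "open (half_dom r N)"
proof -
  have "half_dom r N = (\<Inter>i\<in>{..<r}. {s. real i + 1 - N < Re (\<Sum>j\<le>i. s j)})"
    unfolding half_dom_def by auto
  also have "open \<dots>"
    by (intro open_INT ballI open_Collect_less continuous_intros continuous_on_coordinate) auto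
  finally show ?thesis .
qed

lemma half_dom_mono: "N \<le> M \<Longrightarrow> half_dom r N \<subseteq> half_dom r M"
  unfolding half_dom_def by fastforce

lemma half_dom_anti: "q \<le> r \<Longrightarrow> half_dom r N \<subseteq> half_dom q N"
  unfolding half_dom_def by auto

text \<open>Finitely many strict inequalities leave room for an exponent \<open>1 + e\<close>: the
  norm estimate needs \<open>i p\<close> below the \<open>i\<close>-th partial sum, and summability
  needs \<open>p > 1\<close>.\<close>

lemma half_dom_slack:
  assumes "p \<in> half_dom r N"
  shows "\<exists>e>0. \<forall>i<r. real (Suc i) * (1 + e) < Re (\<Sum>j\<le>i. p j) + N"
proof -
  have "\<forall>\<^sub>F e in at_right 0. \<forall>i\<in>{..<r}. real (Suc i) * (1 + e) < Re (\<Sum>j\<le>i. p j) + N"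
  proof (intro eventually_ball_finite ballI)
    fix i assume i: "i \<in> {..<r}"
    have "((\<lambda>e. real (Suc i) * (1 + e)) \<longlongrightarrow> real (Suc i) * (1 + 0)) (at_right 0)"
      by (intro tendsto_intros)
    thus "\<forall>\<^sub>F e in at_right 0. real (Suc i) * (1 + e) < Re (\<Sum>j\<le>i. p j) + N"
      by (rule order_tendstoD) (use assms i in \<open>auto simp: half_dom_def dest!: spec[of _ i]\<close>)
  qed auto
  moreover have "\<forall>\<^sub>F e in at_right (0::real). 0 < e" by (rule eventually_at_right_less)
  ultimately have "\<forall>\<^sub>F e in at_right 0. 0 < e \<and> (\<forall>i\<in>{..<r}. real (Suc i) * (1 + e) < Re (\<Sum>j\<le>i. p j) + N)"
    by eventually_elim auto
  thus ?thesis using eventually_happens[of _ "at_right (0::real)"] by force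
qed

text \<open>
  A first factor that is smaller by \<open>m\<^sup>-\<^sup>N\<close> acts like the translation \<open>s\<^sub>1 + N\<close>, hence convergence for
  all \<open>s\<close> with \<open>Re \<sigma>\<^sub>i > i - N\<close>.
\<close>

lemma weighted_tail_sum:
  fixes h :: "complex \<Rightarrow> nat \<Rightarrow> complex"
  assumes a: "\<And>i. i < Suc r \<Longrightarrow> norm (\<Prod>j\<le>i. a j) \<le> 1"
    and h: "\<And>m. m \<ge> 2 \<Longrightarrow> (\<lambda>u. h u m) holomorphic_on UNIV"
    and bound: "\<And>M. \<exists>C\<ge>0. \<forall>u m. norm u \<le> M \<longrightarrow> m \<ge> 2 \<longrightarrow>
           norm (h u m) \<le> C * (norm (a 0) ^ m * real m powr (- Re u - N))"
  defines "t \<equiv> \<lambda>n s. h (s 0) (n 0) *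
             tail_term r (\<lambda>i. a (Suc i)) (\<lambda>i. s (Suc i)) (\<lambda>i. n (Suc i))"
  shows "separately_holo (half_dom (Suc r) N) (\<lambda>s. \<Sum>\<^sub>\<infinity>n\<in>desc_tails (Suc r). t n s)"
    and "\<And>s. s \<in> half_dom (Suc r) N \<Longrightarrow> (\<lambda>n. t n s) summable_on desc_tails (Suc r)"
proof -
  have dom: "\<exists>V M. open V \<and> p \<in> V \<and> V \<subseteq> half_dom (Suc r) N \<and> M summable_on desc_tails (Suc r) \<and>
      (\<forall>n\<in>desc_tails (Suc r). \<forall>s\<in>V. norm (t n s) \<le> M n)" if p: "p \<in> half_dom (Suc r) N" for p
  proof -
    obtain e where e: "e > 0" "\<And>i. i < Suc r \<Longrightarrow> real (Suc i) * (1 + e) < Re (\<Sum>j\<le>i. p j) + N"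
      using half_dom_slack[OF p] by blast
    obtain C where C: "C \<ge> 0" "\<And>u m. norm u \<le> norm (p 0) + 1 \<Longrightarrow> m \<ge> 2 \<Longrightarrow>
           norm (h u m) \<le> C * (norm (a 0) ^ m * real m powr (- Re u - N))"
      using bound[of "norm (p 0) + 1"] by blast
    \<comment> \<open>The bound on \<open>s 0\<close> is present because \<open>C\<close> depends on
      the size of the argument; the other inequalities keep the exponent \<open>1 + e\<close>
      admissible on all of \<open>V\<close>.\<close>
    define V where "V = {s. norm (s 0) < norm (p 0) + 1} \<inter>
        (\<Inter>i\<in>{..<Suc r}. {s. real (Suc i) * (1 + e) < Re (\<Sum>j\<le>i. s j) + N})"
    define M where "M n = C * (norm (\<Prod>j\<le>Suc r. a j) * (\<Prod>i<Suc r. real (n i) powr (- (1 + e))))"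
      for n :: "nat \<Rightarrow> nat"
    have "open V" unfolding V_def
      by (intro open_Int open_INT ballI open_Collect_less continuous_intros continuous_on_coordinate) auto
    moreover have "p \<in> V" using e unfolding V_def by auto
    moreover have "V \<subseteq> half_dom (Suc r) N"
    proof
      fix s assume s: "s \<in> V"
      show "s \<in> half_dom (Suc r) N" unfolding half_dom_def
      proof (intro CollectI allI impI)
        fix i assume i: "i < Suc r"
        have "real (Suc i) * (1 + e) < Re (\<Sum>j\<le>i. s j) + N" using s i unfolding V_def by auto
        moreover have "0 < real (Suc i) * e" using e by simp
        ultimately show "real i + 1 - N < Re (\<Sum>j\<le>i. s j)" by (simp add: algebra_simps)
      qed
    qed
    moreover have "M summable_on desc_tails (Suc r)" unfolding M_def
      using e by (intro summable_on_cmult_right summable_on_prod_powr) auto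
    moreover have "norm (t n s) \<le> M n" if n: "n \<in> desc_tails (Suc r)" and s: "s \<in> V" for n s
    proof -
      define s' where "s' = s(0 := s 0 + of_real N)"
      let ?T = "tail_term r (\<lambda>i. a (Suc i)) (\<lambda>i. s (Suc i)) (\<lambda>i. n (Suc i))"
      have sum': "(\<Sum>j\<le>i. s' j) = (\<Sum>j\<le>i. s j) + of_real N" for i
        unfolding s'_def by (induction i) auto
      have n0: "n 0 \<ge> 2" using desc_tails_ge2[OF n] by simp
      have "norm (t n s) = norm (h (s 0) (n 0)) * norm ?T" by (simp add: t_def norm_mult)
      also have "\<dots> \<le> C * (norm (a 0) ^ n 0 * real (n 0) powr (- Re (s 0) - N)) * norm ?T"
        using C(2)[of "s 0" "n 0"] s n0 by (intro mult_right_mono) (auto simp: V_def)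
      also have "\<dots> = C * norm (tail_term (Suc r) a s' n)"
        unfolding tail_term_Suc norm_mult[of "_ * _" "tail_term _ _ _ _"]
        using n0 by (subst norm_tail_factor) (auto simp: s'_def)
      also have "\<dots> \<le> M n" unfolding M_def using a C(1) n s e(1)
        by (intro mult_left_mono norm_tail_term) (auto simp: sum' V_def intro: less_imp_le simp del: of_nat_Suc sum.atMost_Suc prod.atMost_Suc)
      finally show ?thesis .
    qed
    ultimately show ?thesis by blast
  qed
  have holo: "separately_holo (half_dom (Suc r) N) (t n)" if n: "n \<in> desc_tails (Suc r)" for n
  proof -
    have pw: "(\<lambda>u. of_nat m powr (- u)) holomorphic_on UNIV" for m
      by (cases "m = 0") (auto intro!: holomorphic_intros)
    have 1: "separately_holo W (\<lambda>s. h (s 0) (n 0))" for W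
      using separately_holo_entire[OF separately_holo_coord h] desc_tails_ge2[OF n, of 0] by simp
    have 2: "separately_holo W (\<lambda>s. of_nat (n j) powr (- s i))" for W j i
      using separately_holo_entire[OF separately_holo_coord pw] by simp
    show ?thesis unfolding t_def tail_term_def
      by (intro separately_holo_intros 1 2)
  qed
  show "separately_holo (half_dom (Suc r) N) (\<lambda>s. \<Sum>\<^sub>\<infinity>n\<in>desc_tails (Suc r). t n s)"
    by (rule separately_holo_infsum[OF open_half_dom holo dom])
  show "(\<lambda>n. t n s) summable_on desc_tails (Suc r)" if s: "s \<in> half_dom (Suc r) N" for s
  proof -
    obtain V M where "s \<in> V" "M summable_on desc_tails (Suc r)"
      "\<forall>n\<in>desc_tails (Suc r). \<forall>s\<in>V. norm (t n s) \<le> M n" using dom[OF s] by blast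
    hence "(\<lambda>n. norm (t n s)) summable_on desc_tails (Suc r)"
      by (intro Infinite_Sum.abs_summable_on_comparison_test'[of M]) auto
    thus ?thesis by (rule abs_summable_summable)
  qed
qed

section \<open>Binomial expansion and the recursion\<close>

text \<open>This is the error of the expansion of
  \<open>(m - 1)^(-u) = m^(-u) (1 - 1/m)^(-u)\<close> in powers of \<open>1/m\<close>, cut after
  order \<open>K\<close>. The sign in the binomial coefficient of \<open>-u\<close> cancels that of
  \<open>-1/m\<close>, which leaves Pochhammer symbols.\<close>

definition binomial_remainder :: "nat \<Rightarrow> complex \<Rightarrow> nat \<Rightarrow> complex" where
  "binomial_remainder K u m = of_nat (m - 1) powr (- u) -
     (\<Sum>k\<le>K. pochhammer u k / fact k * of_nat m powr (- u - of_nat k))"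

lemma norm_pochhammer_le: "norm u \<le> M \<Longrightarrow> norm (pochhammer u k) \<le> pochhammer M k"
  for u :: complex
proof (induction k)
  case (Suc k)
  have "norm (u + of_nat k) \<le> M + real k"
    using Suc.prems norm_triangle_ineq[of u "of_nat k"] by simp
  moreover have "0 \<le> pochhammer M k" using Suc norm_ge_zero order_trans by blast
  ultimately show ?case using Suc by (simp add: pochhammer_Suc norm_mult mult_mono)
qed auto

lemma binomial_series_reflected:
  fixes u :: complex
  assumes "m \<ge> 2"
  shows "(\<lambda>k. pochhammer u k / fact k * of_nat m powr (- u - of_nat k)) sums of_nat (m - 1) powr (- u)"
proof -
  define z :: complex where "z = - 1 / of_nat m"
  have "norm z < 1" using assms by (simp add: z_def norm_divide)
  from gen_binomial_complex[OF this, of "-u"]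
  have "(\<lambda>k. of_nat m powr (- u) * ((- u gchoose k) * z ^ k)) sums (of_nat m powr (- u) * (1 + z) powr (- u))"
    by (rule sums_mult)
  also have "1 + z = of_real (real (m - 1) / real m)"
    using assms by (simp add: z_def of_nat_diff field_simps)
  also have "of_nat m powr (- u) * of_real (real (m - 1) / real m) powr (- u) =
      (of_nat m * of_real (real (m - 1) / real m)) powr (- u)"
    by (rule powr_times_real[symmetric]) (auto simp del: of_real_divide)
  also have "of_nat m * of_real (real (m - 1) / real m) = (of_nat (m - 1) :: complex)"
    using assms by simp
  also have "(\<lambda>k. of_nat m powr (- u) * ((- u gchoose k) * z ^ k)) =
      (\<lambda>k. pochhammer u k / fact k * of_nat m powr (- u - of_nat k))"
  proof
    fix k
    have "of_nat m powr (- u - of_nat k) = of_nat m powr (- u) / of_nat m ^ k"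
      using assms by (simp add: powr_diff powr_nat')
    moreover have "z ^ k = (- 1) ^ k / of_nat m ^ k" unfolding z_def by (rule power_divide)
    moreover have "(- 1) ^ k * (- 1) ^ k = (1 :: complex)" by (simp flip: power_mult_distrib)
    ultimately show "of_nat m powr (- u) * ((- u gchoose k) * z ^ k) =
        pochhammer u k / fact k * of_nat m powr (- u - of_nat k)"
      by (simp add: gbinomial_pochhammer)
  qed
  finally show ?thesis .
qed

text \<open>After \<open>K + 1\<close> powers of \<open>1/m\<close> are taken out, the others are at
  most powers of 1/2 because \<open>m \<ge> 2\<close>, and the coefficients are bounded by those for
  the real argument \<open>M\<close>. What remains is a tail of the series of
  \<open>(1 - 1/2)^(-M)\<close>, independent of \<open>u\<close> and \<open>m\<close>.\<close>

lemma binomial_remainder_bound: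
  assumes "M \<ge> 0"
  shows "\<exists>C\<ge>0. \<forall>u m. norm u \<le> M \<longrightarrow> m \<ge> 2 \<longrightarrow>
    norm (binomial_remainder K u m) \<le> C * real m powr (- Re u - real K - 1)"
proof -
  define b where "b k = pochhammer M k / fact k * (1 / 2) ^ k" for k
  have b0: "pochhammer M k \<ge> 0" for k
    using assms by (induction k) (auto simp: pochhammer_Suc)
  have "summable (\<lambda>k. (- M gchoose k) * (- 1 / 2) ^ k)"
    using gen_binomial_real[of "- 1 / 2" "- M"] by (simp add: sums_iff)
  also have "(\<lambda>k. (- M gchoose k) * (- 1 / 2) ^ k) = b"
  proof
    fix k
    have "(- 1 / 2) ^ k = (- 1) ^ k * (1 / 2 :: real) ^ k" by (simp flip: power_mult_distrib)
    moreover have "(- 1) ^ k * (- 1) ^ k = (1 :: real)" by (simp flip: power_mult_distrib)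
    ultimately show "(- M gchoose k) * (- 1 / 2) ^ k = b k"
      unfolding b_def gbinomial_pochhammer by (simp add: field_simps)
  qed
  finally have sb: "summable (\<lambda>k. b (k + Suc K))" by (subst summable_iff_shift)
  \<comment> \<open>\<open>b (k + Suc K)\<close> contains \<open>Suc K\<close> powers of 1/2 that
    the estimate does not produce; the prefactor undoes them.\<close>
  let ?C = "2 ^ Suc K * (\<Sum>k. b (k + Suc K))"
  have "norm (binomial_remainder K u m) \<le> ?C * real m powr (- Re u - real K - 1)"
    if u: "norm u \<le> M" and m: "m \<ge> 2" for u m
  proof -
    let ?f = "\<lambda>k. pochhammer u k / fact k * of_nat m powr (- u - of_nat k)"
    let ?g = "\<lambda>k. 2 ^ Suc K * b (k + Suc K) * real m powr (- Re u - real K - 1)"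
    have "(\<lambda>k. ?f (k + Suc K)) sums (of_nat (m - 1) powr (- u) - (\<Sum>k<Suc K. ?f k))"
      using binomial_series_reflected[OF m, of u] by (subst sums_iff_shift')
    hence sums: "(\<lambda>k. ?f (k + Suc K)) sums binomial_remainder K u m"
      unfolding binomial_remainder_def lessThan_Suc_atMost .
    have le: "norm (?f (k + Suc K)) \<le> ?g k" for k
    proof -
      have "norm (?f (k + Suc K)) =
          norm (pochhammer u (k + Suc K)) / fact (k + Suc K) * real m powr (- Re u - real (k + Suc K))"
        using m by (simp add: norm_mult norm_divide norm_powr_real_powr del: fact_Suc)
      also have "real m powr (- Re u - real (k + Suc K)) =
          real m powr (- Re u - real K - 1) * real m powr (- real k)"
        by (simp add: powr_add[symmetric] algebra_simps)
      also have "real m powr (- real k) = (1 / real m) ^ k"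
        using m by (simp add: powr_minus powr_realpow power_divide divide_simps)
      also have "norm (pochhammer u (k + Suc K)) / fact (k + Suc K) *
            (real m powr (- Re u - real K - 1) * (1 / real m) ^ k)
          \<le> pochhammer M (k + Suc K) / fact (k + Suc K) *
            (real m powr (- Re u - real K - 1) * (1 / 2) ^ k)"
        using m b0 norm_pochhammer_le[OF u, of "k + Suc K"]
        by (intro mult_mono divide_right_mono power_mono) (auto simp: field_simps)
      also have "\<dots> = ?g k" by (simp add: b_def power_add power_divide)
      finally show ?thesis .
    qed
    have sg: "summable ?g" using sb by (intro summable_mult2 summable_mult)
    have sn: "summable (\<lambda>k. norm (?f (k + Suc K)))"
      by (rule summable_comparison_test[OF _ sg]) (use le in auto)
    have "norm (binomial_remainder K u m) \<le> (\<Sum>k. norm (?f (k + Suc K)))"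
      unfolding sums_unique[OF sums] by (rule summable_norm[OF sn])
    also have "\<dots> \<le> (\<Sum>k. ?g k)" by (rule suminf_le[OF le sn sg])
    also have "\<dots> = ?C * real m powr (- Re u - real K - 1)"
      using sb by (simp add: suminf_mult suminf_mult2[symmetric] summable_mult)
    finally show ?thesis .
  qed
  moreover have "?C \<ge> 0" using b0 sb by (intro mult_nonneg_nonneg suminf_nonneg) (auto simp: b_def)
  ultimately show ?thesis by blast
qed

lemma holomorphic_binomial_remainder:
  "(\<lambda>u. binomial_remainder K (u - c) m) holomorphic_on UNIV" if "m \<ge> 2"
proof -
  have "(\<lambda>u. of_nat (m - 1) powr (- (u - c))) holomorphic_on UNIV"
    using that by (auto intro!: holomorphic_intros)
  moreover have "(\<lambda>u. pochhammer (u - c) k / fact k * of_nat m powr (- (u - c) - of_nat k)) holomorphic_on UNIV" for k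
    using that by (auto intro!: holomorphic_intros)
  ultimately show ?thesis unfolding binomial_remainder_def
    by (intro holomorphic_on_diff holomorphic_on_sum)
qed

text \<open>For positive depth this is the weighted sum whose weight is the first factor itself,
  with \<open>N = 0\<close> and \<open>C = 1\<close>; at depth 0 there is one tuple only.\<close>

lemma tail_term_summable_and_holo:
  assumes "\<And>i. i < r \<Longrightarrow> norm (\<Prod>j\<le>i. a j) \<le> 1"
  shows "separately_holo (half_dom r 0) (tail_L r a)"
    and "s \<in> half_dom r 0 \<Longrightarrow> tail_term r a s summable_on desc_tails r"
proof -
  have "separately_holo (half_dom r 0) (tail_L r a) \<and>
    (\<forall>s\<in>half_dom r 0. tail_term r a s summable_on desc_tails r)"
  proof (cases r)
    case 0
    have "tail_L 0 a = (\<lambda>s. a 0)" by (auto simp: tail_L_def tail_term_def desc_tails_0)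
    with 0 show ?thesis by (auto simp: desc_tails_0 separately_holo_const)
  next
    case (Suc q)
    have h: "(\<lambda>u. a 0 ^ m * of_nat m powr (- u)) holomorphic_on UNIV" if "m \<ge> 2" for m
      using that by (intro holomorphic_intros) auto
    have b: "\<exists>C\<ge>0. \<forall>u m. norm u \<le> M \<longrightarrow> m \<ge> 2 \<longrightarrow> norm (a 0 ^ m * of_nat m powr (- u))
        \<le> C * (norm (a 0) ^ m * real m powr (- Re u - 0))" for M
      by (intro exI[of _ 1]) (auto simp: norm_tail_factor)
    note w = weighted_tail_sum[of q a "\<lambda>u m. a 0 ^ m * of_nat m powr (- u)" 0, OF _ h b, folded tail_term_Suc tail_L_def]
    show ?thesis unfolding Suc using w assms Suc unfolding tail_L_def by blast
  qed
  thus "separately_holo (half_dom r 0) (tail_L r a)"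
    and "s \<in> half_dom r 0 \<Longrightarrow> tail_term r a s summable_on desc_tails r" by auto
qed

text \<open>Telescoping evaluates the sum in its natural order only; the assumed unconditional
  summability guarantees that the unordered sum has the same value.\<close>

lemma tail_has_sum_telescope:
  fixes a u T :: complex
  assumes a: "norm a \<le> 1" and u: "Re u > 0" and p: "p \<ge> 1"
    and summ: "(\<lambda>m. (a ^ (m - 1) * of_nat (m - 1) powr (- u) - a ^ m * of_nat m powr (- u)) * T)
      summable_on {p<..}"
  shows "((\<lambda>m. (a ^ (m - 1) * of_nat (m - 1) powr (- u) - a ^ m * of_nat m powr (- u)) * T)
      has_sum (a ^ p * of_nat p powr (- u) * T)) {p<..}"
proof -
  define c where "c m = a ^ m * of_nat m powr (- u) * T" for m
  have "(\<lambda>m. of_nat m powr (- u)) \<longlonglongrightarrow> (0::complex)"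
    by (rule tendsto_neg_powr_complex_of_nat) (use u in \<open>auto intro: filterlim_ident\<close>)
  hence "(\<lambda>m. norm (of_nat m powr (- u) :: complex) * norm T) \<longlonglongrightarrow> 0"
    using tendsto_mult_left_zero tendsto_norm_zero by blast
  hence "c \<longlonglongrightarrow> 0"
  proof (rule Lim_null_comparison[rotated], intro always_eventually allI)
    fix m
    have "norm a ^ m * (norm (of_nat m powr (- u) :: complex) * norm T) \<le>
        norm (of_nat m powr (- u) :: complex) * norm T"
      using a by (intro mult_left_le_one_le) (auto simp: power_le_one)
    thus "norm (c m) \<le> norm (of_nat m powr (- u) :: complex) * norm T"
      by (simp add: c_def norm_mult norm_power mult_ac)
  qed
  hence "(\<lambda>j. c (j + p)) \<longlonglongrightarrow> 0" by (rule LIMSEQ_ignore_initial_segment)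
  from telescope_sums'[OF this] have s: "(\<lambda>j. c (j + p) - c (Suc j + p)) sums c p" by simp
  have bij: "bij_betw (\<lambda>j. Suc j + p) UNIV {p<..}"
    by (rule bij_betwI[of _ _ _ "\<lambda>m. m - Suc p"]) auto
  let ?f = "\<lambda>m. (a ^ (m - 1) * of_nat (m - 1) powr (- u) - a ^ m * of_nat m powr (- u)) * T"
  obtain S where S: "(?f has_sum S) {p<..}" using summ unfolding summable_on_def by blast
  hence "((\<lambda>j. ?f (Suc j + p)) has_sum S) UNIV"
    by (subst has_sum_reindex_bij_betw[OF bij])
  hence "(\<lambda>j. ?f (Suc j + p)) sums S" by (rule has_sum_imp_sums)
  also have "(\<lambda>j. ?f (Suc j + p)) = (\<lambda>j. c (j + p) - c (Suc j + p))"
    by (auto simp: c_def algebra_simps)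
  finally have "S = c p" using s sums_unique2 by blast
  thus ?thesis using S by (simp add: c_def)
qed

definition shift_arg :: "complex \<Rightarrow> (nat \<Rightarrow> complex) \<Rightarrow> nat \<Rightarrow> complex" where
  "shift_arg c s = s(0 := s 0 + c)"

lemma sum_shift_arg: "(\<Sum>j\<le>i. shift_arg c s j) = (\<Sum>j\<le>i. s j) + c"
  by (induction i) (auto simp: shift_arg_def)

lemma shift_arg_half_dom: "s \<in> half_dom r N \<Longrightarrow> N - M \<le> Re c \<Longrightarrow> shift_arg c s \<in> half_dom r M"
  unfolding half_dom_def by (fastforce simp: sum_shift_arg)

lemma tail_term_shift:
  "a 0 ^ n 0 * of_nat (n 0) powr (- (s 0 + c)) *
     tail_term r (\<lambda>i. a (Suc i)) (\<lambda>i. s (Suc i)) (\<lambda>i. n (Suc i)) = tail_term (Suc r) a (shift_arg c s) n"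
  by (simp add: tail_term_Suc shift_arg_def)

lemma has_sum_sum_finite:
  fixes f :: "'i \<Rightarrow> 'x \<Rightarrow> 'c :: {topological_comm_monoid_add, t2_space}"
  assumes "finite I" "\<And>k. k \<in> I \<Longrightarrow> (f k has_sum S k) A"
  shows "((\<lambda>x. \<Sum>k\<in>I. f k x) has_sum (\<Sum>k\<in>I. S k)) A"
  using assms by (induction I rule: finite_induct) (auto intro: has_sum_add)

text \<open>One double sum, over a tuple and a larger index \<open>m\<close>, is evaluated twice:
  expanded term by term, and row by row, where each row telescopes. The factor \<open>a 0\<close>
  turns \<open>a 0 ^ (m - 1)\<close> into \<open>a 0 ^ m\<close> without a division.\<close>

lemma tail_L_recursion:
  assumes a: "\<And>i. i < Suc r \<Longrightarrow> norm (\<Prod>j\<le>i. a j) \<le> 1"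
    and d: "d \<in> {0, 1}" "d = 1 \<Longrightarrow> a 0 = 1"
  obtains R where "separately_holo (half_dom (Suc r) (real N)) R"
    "\<And>s. s \<in> half_dom (Suc r) 0 \<Longrightarrow>
       (1 - a 0) * tail_L (Suc r) a s
       + (\<Sum>k=1..N. pochhammer (s 0 - d) k / fact k * tail_L (Suc r) a (shift_arg (of_nat k - d) s))
       + R s = a 0 * tail_L r (merge_base a) (merge_arg d s)"
proof -
  define h where "h v m = a 0 ^ m * binomial_remainder N (v - d) m" for v m
  define T where "T n s = tail_term r (\<lambda>i. a (Suc i)) (\<lambda>i. s (Suc i)) n" for n s
  define R where "R s = (\<Sum>\<^sub>\<infinity>n\<in>desc_tails (Suc r). h (s 0) (n 0) * T (\<lambda>i. n (Suc i)) s)" for s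
  have Red: "Re d \<le> 1" "0 \<le> Re d" "norm d \<le> 1" using d(1) by auto
  have hh: "(\<lambda>v. h v m) holomorphic_on UNIV" if "m \<ge> 2" for m
    unfolding h_def using holomorphic_binomial_remainder[OF that] by (intro holomorphic_intros)
  have hb: "\<exists>C\<ge>0. \<forall>v m. norm v \<le> M \<longrightarrow> m \<ge> 2 \<longrightarrow>
      norm (h v m) \<le> C * (norm (a 0) ^ m * real m powr (- Re v - real N))" for M
  proof -
    obtain C where C: "C \<ge> 0" "\<And>u m. norm u \<le> max 0 M + 1 \<Longrightarrow> m \<ge> 2 \<Longrightarrow>
        norm (binomial_remainder N u m) \<le> C * real m powr (- Re u - real N - 1)"
      using binomial_remainder_bound[of "max 0 M + 1" N] by auto
    have "norm (h v m) \<le> C * (norm (a 0) ^ m * real m powr (- Re v - real N))"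
      if v: "norm v \<le> M" and m: "m \<ge> 2" for v m
    proof -
      have "norm (v - d) \<le> max 0 M + 1" using norm_triangle_ineq4[of v d] v Red by linarith
      hence "norm (binomial_remainder N (v - d) m) \<le> C * real m powr (- Re (v - d) - real N - 1)"
        using C m by blast
      \<comment> \<open>Replacing \<open>v - d\<close> by \<open>v\<close> costs at most one power
        of \<open>m\<close>, which is the additional power in the remainder bound.\<close>
      also have "\<dots> \<le> C * real m powr (- Re v - real N)"
        using C(1) m Red by (intro mult_left_mono powr_mono) auto
      finally have "norm (a 0) ^ m * norm (binomial_remainder N (v - d) m) \<le>
          norm (a 0) ^ m * (C * real m powr (- Re v - real N))" by (rule mult_left_mono) auto
      thus ?thesis by (simp add: h_def norm_mult norm_power mult_ac)
    qed
    thus ?thesis using C(1) by blast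
  qed
  note W = weighted_tail_sum[of r a h "real N", OF a hh hb, folded T_def]
  have "separately_holo (half_dom (Suc r) (real N)) R" unfolding R_def by (rule W(1))
  moreover have "(1 - a 0) * tail_L (Suc r) a s
       + (\<Sum>k=1..N. pochhammer (s 0 - d) k / fact k * tail_L (Suc r) a (shift_arg (of_nat k - d) s))
       + R s = a 0 * tail_L r (merge_base a) (merge_arg d s)" if s: "s \<in> half_dom (Suc r) 0" for s
  proof -
    define u where "u = s 0 - d"
    have "Re (s 0) > 1" using s unfolding half_dom_def by (auto dest!: spec[of _ 0])
    hence u: "Re u > 0" using Red by (simp add: u_def)
    define E where "E m = a 0 ^ (m - 1) * of_nat (m - 1) powr (- u) - a 0 ^ m * of_nat m powr (- u)" for m
    let ?S = "(1 - a 0) * tail_L (Suc r) a s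
       + (\<Sum>k=1..N. pochhammer u k / fact k * tail_L (Suc r) a (shift_arg (of_nat k - d) s)) + R s"
    have E: "a 0 * E m = (1 - a 0) * (a 0 ^ m * of_nat m powr (- s 0))
        + (\<Sum>k=1..N. pochhammer u k / fact k * (a 0 ^ m * of_nat m powr (- (s 0 + (of_nat k - d)))))
        + h (s 0) m" if "m \<ge> 2" for m
    proof -
      have "a 0 * a 0 ^ (m - 1) = a 0 ^ m" using that by (cases m) auto
      hence "a 0 * E m = a 0 ^ m * of_nat (m - 1) powr (- u) - a 0 * a 0 ^ m * of_nat m powr (- u)"
        by (simp add: E_def algebra_simps)
      also have "of_nat (m - 1) powr (- u) = binomial_remainder N u m +
          (\<Sum>k\<le>N. pochhammer u k / fact k * of_nat m powr (- u - of_nat k))"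
        by (simp add: binomial_remainder_def)
      also have "{..N} = insert 0 {1..N}" by auto
      also have "(\<Sum>k\<in>insert 0 {1..N}. pochhammer u k / fact k * of_nat m powr (- u - of_nat k)) =
          of_nat m powr (- u) + (\<Sum>k=1..N. pochhammer u k / fact k * of_nat m powr (- u - of_nat k))"
        by simp
      finally have "a 0 * E m = (1 - a 0) * (a 0 ^ m * of_nat m powr (- u))
          + (\<Sum>k=1..N. pochhammer u k / fact k * (a 0 ^ m * of_nat m powr (- u - of_nat k)))
          + h (s 0) m"
        by (simp add: h_def u_def algebra_simps sum_distrib_left)
      \<comment> \<open>Either \<open>d = 0\<close> and the exponents agree, or
        \<open>a 0 = 1\<close> and both sides vanish.\<close>
      also have "(1 - a 0) * (a 0 ^ m * of_nat m powr (- u)) = (1 - a 0) * (a 0 ^ m * of_nat m powr (- s 0))"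
        using d by (auto simp: u_def)
      finally show ?thesis by (simp add: u_def algebra_simps)
    qed
    have hs: "(tail_term (Suc r) a (shift_arg c s) has_sum tail_L (Suc r) a (shift_arg c s)) (desc_tails (Suc r))"
      if "Re c \<ge> 0" for c
      unfolding tail_L_def using that s
      by (intro has_sum_infsum tail_term_summable_and_holo(2) a) (auto intro: shift_arg_half_dom)
    have c0: "shift_arg 0 s = s" by (simp add: shift_arg_def)
    have R: "((\<lambda>n. h (s 0) (n 0) * T (\<lambda>i. n (Suc i)) s) has_sum R s) (desc_tails (Suc r))"
      unfolding R_def by (rule has_sum_infsum, rule W(2)) (use s half_dom_mono[of 0 "real N"] in auto)
    have "((\<lambda>n. (1 - a 0) * tail_term (Suc r) a (shift_arg 0 s) n
        + (\<Sum>k=1..N. pochhammer u k / fact k * tail_term (Suc r) a (shift_arg (of_nat k - d) s) n)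
        + h (s 0) (n 0) * T (\<lambda>i. n (Suc i)) s) has_sum ?S) (desc_tails (Suc r))"
      using Red hs[of 0] by (intro has_sum_add R has_sum_sum_finite has_sum_cmult_right hs) (auto simp: c0)
    also have "?this \<longleftrightarrow> ((\<lambda>n. a 0 * E (n 0) * T (\<lambda>i. n (Suc i)) s) has_sum ?S) (desc_tails (Suc r))"
      by (rule has_sum_cong, subst E)
         (auto simp: desc_tails_ge2 T_def tail_term_shift[symmetric] algebra_simps sum_distrib_left)
    also have "\<dots> \<longleftrightarrow> ((\<lambda>x. a 0 * E ((case x of (n, m) \<Rightarrow> case_nat m n) 0) *
        T (\<lambda>i. (case x of (n, m) \<Rightarrow> case_nat m n) (Suc i)) s) has_sum ?S) (SIGMA n:desc_tails r. {n 0<..})"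
      by (rule has_sum_reindex_bij_betw[OF desc_tails_Suc, symmetric])
    also have "\<dots> \<longleftrightarrow> ((\<lambda>(n, m). E m * (a 0 * T n s)) has_sum ?S) (SIGMA n:desc_tails r. {n 0<..})"
      by (rule has_sum_cong) (auto simp: mult_ac)
    finally have tot: "((\<lambda>(n, m). E m * (a 0 * T n s)) has_sum ?S) (SIGMA n:desc_tails r. {n 0<..})" .
    have "((\<lambda>m. E m * (a 0 * T n s)) has_sum (a 0 ^ n 0 * of_nat (n 0) powr (- u) * (a 0 * T n s))) {n 0<..}"
      if n: "n \<in> desc_tails r" for n
      unfolding E_def
    proof (rule tail_has_sum_telescope[OF _ u desc_tails_ge1[OF n]])
      show "norm (a 0) \<le> 1" using a[of 0] by simp
      show "(\<lambda>m. (a 0 ^ (m - 1) * of_nat (m - 1) powr - u - a 0 ^ m * of_nat m powr - u) *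
         (a 0 * T n s)) summable_on {n 0<..}"
        using summable_on_SigmaD1[of "\<lambda>n m. E m * (a 0 * T n s)" "desc_tails r" "\<lambda>n. {n 0<..}" n] tot n
        unfolding E_def summable_on_def by blast
    qed
    hence "((\<lambda>n. a 0 ^ n 0 * of_nat (n 0) powr (- u) * (a 0 * T n s)) has_sum ?S) (desc_tails r)"
      by (intro has_sum_SigmaD[OF tot]) auto
    also have "?this \<longleftrightarrow> ((\<lambda>n. a 0 * tail_term r (merge_base a) (merge_arg d s) n) has_sum ?S) (desc_tails r)"
    proof (rule has_sum_cong)
      fix n assume "n \<in> desc_tails r"
      hence "a 0 ^ n 0 * of_nat (n 0) powr (- u) * T n s = tail_term r (merge_base a) (merge_arg d s) n"
        unfolding u_def T_def by (intro tail_term_merge desc_tails_ge1)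
      thus "a 0 ^ n 0 * of_nat (n 0) powr (- u) * (a 0 * T n s) =
          a 0 * tail_term r (merge_base a) (merge_arg d s) n"
        by (metis mult.left_commute)
    qed
    finally have 1: "((\<lambda>n. a 0 * tail_term r (merge_base a) (merge_arg d s) n) has_sum ?S) (desc_tails r)" .
    have "merge_arg d s \<in> half_dom r 0" unfolding half_dom_def
    proof (intro CollectI allI impI)
      fix i assume "i < r"
      hence "real (Suc i) + 1 < Re (\<Sum>j\<le>Suc i. s j)" using s unfolding half_dom_def by auto
      thus "real i + 1 - 0 < Re (\<Sum>j\<le>i. merge_arg d s j)" using Red unfolding sum_merge_arg by simp
    qed
    moreover have "norm (\<Prod>j\<le>i. merge_base a j) \<le> 1" if "i < r" for i
      unfolding prod_merge_base using a[of "Suc i"] that by blast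
    ultimately have "((\<lambda>n. a 0 * tail_term r (merge_base a) (merge_arg d s) n) has_sum
        a 0 * tail_L r (merge_base a) (merge_arg d s)) (desc_tails r)"
      unfolding tail_L_def by (intro has_sum_cmult_right has_sum_infsum tail_term_summable_and_holo(2))
    with 1 show ?thesis unfolding u_def using has_sum_unique by blast
  qed
  ultimately show ?thesis using that by blast
qed

section \<open>Entire continuation after clearing the poles\<close>

definition pole_count :: "(nat \<Rightarrow> complex) \<Rightarrow> nat \<Rightarrow> nat" where
  "pole_count a i = card {j. j \<le> i \<and> (\<Prod>l\<le>j. a l) = 1}"

text \<open>
  The case \<open>i = 0\<close> is special because the sum over the first index is over a pure power, without
  lower-order terms, so that it has the pole at \<open>s\<^sub>1 = 1\<close> only.
\<close>

definition pole_factor :: "(nat \<Rightarrow> complex) \<Rightarrow> nat \<Rightarrow> (nat \<Rightarrow> complex) \<Rightarrow> complex" where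
  "pole_factor a i s = (if (\<Prod>l\<le>i. a l) \<noteq> 1 then 1 else if i = 0 then s 0 - 1
     else rGamma ((\<Sum>j\<le>i. s j) - of_nat (pole_count a i)))"

definition pole_prod :: "nat \<Rightarrow> (nat \<Rightarrow> complex) \<Rightarrow> (nat \<Rightarrow> complex) \<Rightarrow> complex" where
  "pole_prod r a s = (\<Prod>i<r. pole_factor a i s)"

lemma separately_holo_rGamma:
  "separately_holo W F \<Longrightarrow> separately_holo W (\<lambda>s. rGamma (F s))"
  by (rule separately_holo_entire[OF _ holomorphic_rGamma])

lemma separately_holo_pochhammer:
  "separately_holo W F \<Longrightarrow> separately_holo W (\<lambda>s. pochhammer (F s) k)"
  by (rule separately_holo_entire) (auto intro!: holomorphic_intros)

lemma separately_holo_pole_factor: "separately_holo W (pole_factor a i)"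
  unfolding pole_factor_def[abs_def]
  by (cases "(\<Prod>l\<le>i. a l) = 1"; cases "i = 0")
     (simp_all, auto intro!: separately_holo_intros separately_holo_rGamma)

lemma separately_holo_pole_prod: "separately_holo W (pole_prod r a)"
  unfolding pole_prod_def[abs_def]
  by (intro separately_holo_prod separately_holo_pole_factor)

lemma pole_count_merge:
  "pole_count a (Suc i) = pole_count (merge_base a) i + (if a 0 = 1 then 1 else 0)"
proof -
  have "{j. j \<le> Suc i \<and> (\<Prod>l\<le>j. a l) = 1} =
      Suc ` {j. j \<le> i \<and> (\<Prod>l\<le>Suc j. a l) = 1} \<union> (if a 0 = 1 then {0} else {})" (is "?A = ?B")
  proof (rule set_eqI)
    show "x \<in> ?A \<longleftrightarrow> x \<in> ?B" for x by (cases x) (auto simp del: prod.atMost_Suc)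
  qed
  also have "card \<dots> = card (Suc ` {j. j \<le> i \<and> (\<Prod>l\<le>Suc j. a l) = 1}) + (if a 0 = 1 then 1 else 0)"
    by (subst card_Un_disjoint) auto
  finally show ?thesis unfolding pole_count_def by (simp add: prod_merge_base card_image)
qed

text \<open>The partial sum and the pole count both drop by \<open>d\<close>, so the argument of
  \<open>rGamma\<close> does not change.\<close>

lemma pole_factor_merge:
  assumes "d = (if a 0 = 1 then 1 else 0)"
  shows "pole_factor a (Suc (Suc i)) s = pole_factor (merge_base a) (Suc i) (merge_arg d s)"
  using assms unfolding pole_factor_def pole_count_merge prod_merge_base sum_merge_arg
  by (auto simp: algebra_simps)

text \<open>Index 1 becomes index 0, where the factor is linear instead of a reciprocal Gamma
  function. The equation \<open>rGamma z = z * rGamma (z + 1)\<close> shows that the linear factor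
  divides the other with entire quotient.\<close>

lemma pole_factor_merge_0:
  assumes "d = (if a 0 = 1 then 1 else 0)"
  shows "\<exists>c. separately_holo UNIV c \<and>
    (\<forall>s. pole_factor a 1 s = c s * pole_factor (merge_base a) 0 (merge_arg d s))"
proof (cases "a 0 * a 1 = 1")
  case True
  have "pole_count (merge_base a) 0 = 1"
    using True unfolding pole_count_def by (auto simp: merge_base_def card_1_singleton_iff)
  hence pc: "pole_count a (Suc 0) = 1 + (if a 0 = 1 then 1 else 0)" by (simp add: pole_count_merge)
  show ?thesis
  proof (intro exI[of _ "\<lambda>s. rGamma (s 0 + s 1 - d - 1 + 1)"] conjI allI)
    show "separately_holo UNIV (\<lambda>s. rGamma (s 0 + s 1 - d - 1 + 1))"
      by (intro separately_holo_rGamma separately_holo_intros)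
    show "pole_factor a 1 s = rGamma (s 0 + s 1 - d - 1 + 1) *
        pole_factor (merge_base a) 0 (merge_arg d s)" for s
      using True assms rGamma_plus1[of "s 0 + s 1 - d - 1"] pc
      by (simp add: pole_factor_def merge_base_def merge_arg_def mult.commute algebra_simps)
  qed
next
  case False
  thus ?thesis by (intro exI[of _ "\<lambda>_. 1"])
    (auto simp: pole_factor_def merge_base_def separately_holo_const)
qed

text \<open>The factor of index 0 is left out on the left-hand side: it has no counterpart after the
  merge, and the coefficients of the recursion provide it.\<close>

lemma pole_prod_merge:
  assumes "d = (if a 0 = 1 then 1 else 0)"
  shows "\<exists>c. separately_holo UNIV c \<and>
    (\<forall>s. (\<Prod>i<r. pole_factor a (Suc i) s) = c s * pole_prod r (merge_base a) (merge_arg d s))"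
proof (cases r)
  case 0
  thus ?thesis by (intro exI[of _ "\<lambda>_. 1"]) (auto simp: pole_prod_def separately_holo_const)
next
  case (Suc q)
  from pole_factor_merge_0[of d a, OF assms] obtain c where c: "separately_holo UNIV c"
    "\<forall>s. pole_factor a 1 s = c s * pole_factor (merge_base a) 0 (merge_arg d s)" by (elim exE conjE)
  have "(\<Prod>i<r. pole_factor a (Suc i) s) = c s * pole_prod r (merge_base a) (merge_arg d s)" for s
    using c(2)[rule_format, of s]
    by (simp add: Suc pole_prod_def prod.lessThan_Suc_shift pole_factor_merge[of d a, OF assms]
          del: prod.lessThan_Suc)
  with c(1) show ?thesis by (intro exI[of _ c] conjI allI)
qed

text \<open>Iterating the functional equation gives
  \<open>rGamma z = pochhammer z k * rGamma (z + k)\<close>, and the translation adds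
  \<open>k\<close> to every partial sum.\<close>

lemma pole_prod_shift:
  "\<exists>c. separately_holo UNIV c \<and> (\<forall>s. (\<Prod>i<r. pole_factor a (Suc i) s) =
       c s * (\<Prod>i<r. pole_factor a (Suc i) (shift_arg (of_nat k) s)))"
proof -
  define c where "c i s = (if (\<Prod>l\<le>Suc i. a l) \<noteq> 1 then 1 else
      pochhammer ((\<Sum>j\<le>Suc i. s j) - of_nat (pole_count a (Suc i))) k)" for i and s :: "nat \<Rightarrow> complex"
  have "separately_holo UNIV (c i)" for i
    unfolding c_def[abs_def]
    by (cases "(\<Prod>l\<le>Suc i. a l) = 1")
       (auto intro!: separately_holo_intros separately_holo_pochhammer simp del: sum.atMost_Suc prod.atMost_Suc)
  hence "separately_holo UNIV (\<lambda>s. \<Prod>i<r. c i s)" by (intro separately_holo_prod)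
  moreover have pf: "pole_factor a (Suc i) s = c i s * pole_factor a (Suc i) (shift_arg (of_nat k) s)" for i s
    using pochhammer_rGamma[of "(\<Sum>j\<le>Suc i. s j) - of_nat (pole_count a (Suc i))" k]
    unfolding pole_factor_def c_def sum_shift_arg by (simp add: algebra_simps del: sum.atMost_Suc prod.atMost_Suc)
  have "(\<Prod>i<r. pole_factor a (Suc i) s) =
       (\<Prod>i<r. c i s) * (\<Prod>i<r. pole_factor a (Suc i) (shift_arg (of_nat k) s))" for s
    unfolding prod.distrib[symmetric] by (rule prod.cong[OF refl pf])
  ultimately show ?thesis by (intro exI[of _ "\<lambda>s. \<Prod>i<r. c i s"] conjI allI)
qed

lemma separately_holo_shift_arg:
  assumes "separately_holo (half_dom r N) F" "M - N \<le> Re c"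
  shows "separately_holo (half_dom r M) (\<lambda>s. F (shift_arg c s))"
proof (rule separately_holo_pullback[OF assms(1)])
  show "continuous_on UNIV (shift_arg c)"
  proof (rule continuous_on_coordinatewise_then_product)
    show "continuous_on UNIV (\<lambda>s. shift_arg c s i)" for i
      by (cases "i = 0") (auto simp: shift_arg_def intro!: continuous_intros continuous_on_coordinate)
  qed
  show "\<And>s. s \<in> half_dom r M \<Longrightarrow> shift_arg c s \<in> half_dom r N"
    using assms(2) by (auto intro: shift_arg_half_dom)
  show "\<exists>i' c'. \<forall>z. shift_arg c (s(i := z)) = (shift_arg c s)(i' := c' + z)" for s i
    by (cases "i = 0")
       (auto simp: shift_arg_def fun_eq_iff intro!: exI[of _ i] exI[of _ "if i = 0 then c else 0"])
qed

lemma merge_arg_half_dom: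
  assumes "s \<in> half_dom (Suc r) N" "Re d \<le> 1"
  shows "merge_arg d s \<in> half_dom r N"
  unfolding half_dom_def
proof (intro CollectI allI impI)
  fix i assume "i < r"
  hence "real (Suc i) + 1 - N < Re (\<Sum>j\<le>Suc i. s j)" using assms(1) unfolding half_dom_def by auto
  thus "real i + 1 - N < Re (\<Sum>j\<le>i. merge_arg d s j)" using assms(2) unfolding sum_merge_arg by simp
qed

lemma separately_holo_merge_arg:
  assumes "separately_holo (half_dom r N) F" "Re d \<le> 1"
  shows "separately_holo (half_dom (Suc r) N) (\<lambda>s. F (merge_arg d s))"
proof (rule separately_holo_pullback[OF assms(1)])
  show "continuous_on UNIV (merge_arg d)"
  proof (rule continuous_on_coordinatewise_then_product)
    show "continuous_on UNIV (\<lambda>s. merge_arg d s i)" for i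
      by (cases "i = 0") (auto simp: merge_arg_def intro!: continuous_intros continuous_on_coordinate)
  qed
  show "\<And>s. s \<in> half_dom (Suc r) N \<Longrightarrow> merge_arg d s \<in> half_dom r N"
    using assms(2) by (auto intro: merge_arg_half_dom)
  show "\<exists>i' c'. \<forall>z. merge_arg d (s(i := z)) = (merge_arg d s)(i' := c' + z)" for s i
  proof -
    \<comment> \<open>Coordinates 0 and 1 both feed coordinate 0 of the image, and all others move
      down by one; truncated subtraction makes \<open>i - 1\<close> correct in each case.\<close>
    have "merge_arg d (s(i := z)) = (merge_arg d s)(i - 1 :=
        (if i = 0 then s 1 - d else if i = 1 then s 0 - d else 0) + z)" for z
      by (cases i; cases "i - 1") (auto simp: merge_arg_def fun_eq_iff)
    thus ?thesis by blast
  qed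
qed

text \<open>The recursion holds on the domain of convergence; solved for the cleared series, it
  defines the extension beyond. Widening the domain by one is possible because translates by
  \<open>k \<ge> 1\<close> return to the previous domain, while the merged series is known at every
  \<open>N\<close> from the smaller depth.\<close>

lemma tail_L_extends:
  assumes "\<And>i. i < r \<Longrightarrow> norm (\<Prod>j\<le>i. a j) \<le> 1"
  shows "\<exists>H. separately_holo (half_dom r (real N)) H \<and>
    (\<forall>s\<in>half_dom r 0. H s = pole_prod r a s * tail_L r a s)"
  using assms
proof (induction r arbitrary: a N)
  case 0
  have "half_dom 0 N = UNIV" for N by (auto simp: half_dom_def)
  thus ?case using tail_term_summable_and_holo(1)[of 0 a]
    by (intro exI[of _ "tail_L 0 a"]) (auto simp: pole_prod_def)
next
  case (Suc r a N)
  define d :: complex where "d = (if a 0 = 1 then 1 else 0)"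
  have d: "d \<in> {0, 1}" "d = 1 \<Longrightarrow> a 0 = 1" "Re d \<le> 1" by (auto simp: d_def split: if_splits)
  have mb: "norm (\<Prod>j\<le>i. merge_base a j) \<le> 1" if "i < r" for i
    unfolding prod_merge_base using Suc.prems[of "Suc i"] that by simp
  let ?P = "\<lambda>s. \<Prod>i<r. pole_factor a (Suc i) s"
  have Q: "pole_prod (Suc r) a s = pole_factor a 0 s * ?P s" for s
    unfolding pole_prod_def by (simp add: prod.lessThan_Suc_shift del: prod.lessThan_Suc)
  have P_holo: "separately_holo W ?P" for W
    by (intro separately_holo_prod separately_holo_pole_factor)
  note prems = Suc.prems and outer_IH = Suc.IH[of "merge_base a"]
  show ?case
  proof (induction N)
    case 0
    show ?case
      using separately_holo_mult[OF separately_holo_pole_prod tail_term_summable_and_holo(1)[OF prems]]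
      by (intro exI[of _ "\<lambda>s. pole_prod (Suc r) a s * tail_L (Suc r) a s"]) simp
  next
    case (Suc N)
    let ?W = "half_dom (Suc r) (real (Suc N))"
    obtain H where H: "separately_holo (half_dom (Suc r) (real N)) H"
      "\<And>s. s \<in> half_dom (Suc r) 0 \<Longrightarrow> H s = pole_prod (Suc r) a s * tail_L (Suc r) a s"
      using Suc.IH by blast
    obtain H' where H': "separately_holo (half_dom r (real (Suc N))) H'"
      "\<And>s. s \<in> half_dom r 0 \<Longrightarrow> H' s = pole_prod r (merge_base a) s * tail_L r (merge_base a) s"
      using outer_IH[of "Suc N"] mb by blast
    obtain R where R: "separately_holo ?W R"
      "\<And>s. s \<in> half_dom (Suc r) 0 \<Longrightarrow>
       (1 - a 0) * tail_L (Suc r) a s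
       + (\<Sum>k=1..Suc N. pochhammer (s 0 - d) k / fact k * tail_L (Suc r) a (shift_arg (of_nat k - d) s))
       + R s = a 0 * tail_L r (merge_base a) (merge_arg d s)"
      using tail_L_recursion[of r a d "Suc N"] prems d by blast
    from pole_prod_merge[of d a r, OF d_def] obtain c' where c': "separately_holo UNIV c'"
      "\<forall>s. ?P s = c' s * pole_prod r (merge_base a) (merge_arg d s)" by (elim exE conjE)
    have "\<forall>k. \<exists>c. separately_holo UNIV c \<and> (\<forall>s. ?P s = c s * ?P (shift_arg (of_nat k) s))"
      by (intro allI pole_prod_shift)
    from choice[OF this] obtain c where "\<forall>k. separately_holo UNIV (c k) \<and>
        (\<forall>s. ?P s = c k s * ?P (shift_arg (of_nat k) s))" ..
    hence c: "\<And>k. separately_holo UNIV (c k)"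
      "\<And>k s. ?P s = c k s * ?P (shift_arg (of_nat k) s)" by auto
    have c_holo: "separately_holo ?W (c k)" "separately_holo ?W c'" for k
      using c(1) c'(1) separately_holo_subset by blast+
    have H_shift: "separately_holo ?W (\<lambda>s. H (shift_arg (of_nat k) s))" if "k \<ge> 1" for k
      using that by (intro separately_holo_shift_arg[OF H(1)]) auto
    have H'_merge: "separately_holo ?W (\<lambda>s. H' (merge_arg d s))"
      by (rule separately_holo_merge_arg[OF H'(1) d(3)])
    have merged: "?P s * tail_L r (merge_base a) (merge_arg d s) = c' s * H' (merge_arg d s)"
      if "s \<in> half_dom (Suc r) 0" for s
      using H'(2)[OF merge_arg_half_dom[OF that d(3)]] unfolding c'(2)[rule_format, of s] by simp
    have shifted: "pole_factor a 0 (shift_arg (of_nat k) s) * (?P s * tail_L (Suc r) a (shift_arg (of_nat k) s))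
        = c k s * H (shift_arg (of_nat k) s)" if "s \<in> half_dom (Suc r) 0" for s k
      using H(2)[of "shift_arg (of_nat k) s"] shift_arg_half_dom[OF that, of 0 "of_nat k"]
      by (simp add: Q c(2)[of s k])
    show ?case
    proof (cases "a 0 = 1")
      case True
      have d1: "d = 1" using True by (simp add: d_def)
      \<comment> \<open>As \<open>d = 1\<close>, the summand \<open>k = 1\<close> of the recursion
        is \<open>s 0 - 1\<close> times the series itself, the quantity to be isolated; the later
        summands are the translates by \<open>1\<close> to \<open>N\<close>.\<close>
      define G where "G s = c' s * H' (merge_arg d s) - (\<Sum>k=1..N. pochhammer (s 0 - 1) k / fact (Suc k) *
          (c k s * H (shift_arg (of_nat k) s))) - ?P s * R s" for s
      have "separately_holo ?W (\<lambda>s. pochhammer (s 0 - 1) k / fact (Suc k))" for k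
        unfolding divide_inverse by (intro separately_holo_intros separately_holo_pochhammer)
      hence "separately_holo ?W G" unfolding G_def[abs_def]
        by (intro separately_holo_diff separately_holo_mult separately_holo_sum c_holo H'_merge P_holo R(1) H_shift) auto
      moreover have "G s = pole_prod (Suc r) a s * tail_L (Suc r) a s" if s: "s \<in> half_dom (Suc r) 0" for s
      proof -
        \<comment> \<open>The last factor \<open>s 0 - 1 + k\<close> of the Pochhammer symbol is the
          pole factor of index 0 of the translate, which \<open>?P\<close> omits.\<close>
        have sh: "pochhammer (s 0 - 1) (Suc k) * (?P s * tail_L (Suc r) a (shift_arg (of_nat k) s)) =
            pochhammer (s 0 - 1) k * (c k s * H (shift_arg (of_nat k) s))" for k
        proof -
          have "pole_factor a 0 (shift_arg (of_nat k) s) = s 0 - 1 + of_nat k"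
            using True by (simp add: pole_factor_def shift_arg_def)
          thus ?thesis unfolding pochhammer_Suc shifted[OF s, symmetric] by (simp only: mult.assoc)
        qed
        have "(\<Sum>k=1..Suc N. pochhammer (s 0 - d) k / fact k * tail_L (Suc r) a (shift_arg (of_nat k - d) s))
            = (\<Sum>k\<le>N. pochhammer (s 0 - 1) (Suc k) / fact (Suc k) * tail_L (Suc r) a (shift_arg (of_nat k) s))"
          unfolding d1
          by (rule sum.reindex_bij_witness[of _ Suc "\<lambda>k. k - 1"]) (auto simp: of_nat_diff)
        also have "{..N} = insert 0 {1..N}" by auto
        also have "(\<Sum>k\<in>insert 0 {1..N}. pochhammer (s 0 - 1) (Suc k) / fact (Suc k) *
              tail_L (Suc r) a (shift_arg (of_nat k) s)) =
            (s 0 - 1) * tail_L (Suc r) a s + (\<Sum>k=1..N. pochhammer (s 0 - 1) (Suc k) / fact (Suc k) *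
              tail_L (Suc r) a (shift_arg (of_nat k) s))"
          by (subst sum.insert) (auto simp: shift_arg_def)
        finally have S: "(\<Sum>k=1..Suc N. pochhammer (s 0 - d) k / fact k *
              tail_L (Suc r) a (shift_arg (of_nat k - d) s)) =
            (s 0 - 1) * tail_L (Suc r) a s + (\<Sum>k=1..N. pochhammer (s 0 - 1) (Suc k) / fact (Suc k) *
              tail_L (Suc r) a (shift_arg (of_nat k) s))" .
        have "(1 - a 0) * tail_L (Suc r) a s = 0" "a 0 * x = x" for x using True by simp_all
        from R(2)[OF s, unfolded S this] have "(s 0 - 1) * tail_L (Suc r) a s = tail_L r (merge_base a) (merge_arg d s) -
            (\<Sum>k=1..N. pochhammer (s 0 - 1) (Suc k) / fact (Suc k) *
              tail_L (Suc r) a (shift_arg (of_nat k) s)) - R s"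
          by (metis (no_types, lifting) add.commute add_0 add_diff_cancel_right' diff_diff_eq)
        hence "?P s * ((s 0 - 1) * tail_L (Suc r) a s) = ?P s * tail_L r (merge_base a) (merge_arg d s) -
            (\<Sum>k=1..N. pochhammer (s 0 - 1) (Suc k) * (?P s *
              tail_L (Suc r) a (shift_arg (of_nat k) s)) / fact (Suc k)) - ?P s * R s"
          by (simp only: right_diff_distrib sum_distrib_left) (simp add: mult_ac)
        moreover have "pole_factor a 0 s = s 0 - 1" using True by (simp add: pole_factor_def)
        ultimately show ?thesis unfolding sh merged[OF s] Q G_def by (simp add: mult_ac)
      qed
      ultimately show ?thesis by blast
    next
      case False
      have d0: "d = 0" using False by (simp add: d_def)
      \<comment> \<open>Now the series has the nonzero constant coefficient \<open>1 - a 0\<close>,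
        so solving for it creates no pole in the first variable.\<close>
      define G where "G s = inverse (1 - a 0) * (a 0 * (c' s * H' (merge_arg d s)) -
          (\<Sum>k=1..Suc N. pochhammer (s 0) k / fact k * (c k s * H (shift_arg (of_nat k) s))) - ?P s * R s)" for s
      have "separately_holo ?W (\<lambda>s. pochhammer (s 0) k / fact k)" for k
        unfolding divide_inverse by (intro separately_holo_intros separately_holo_pochhammer)
      hence "separately_holo ?W G" unfolding G_def[abs_def]
        by (intro separately_holo_diff separately_holo_mult separately_holo_sum c_holo H'_merge P_holo R(1) H_shift
             separately_holo_const) auto
      moreover have "G s = pole_prod (Suc r) a s * tail_L (Suc r) a s" if s: "s \<in> half_dom (Suc r) 0" for s
      proof -
        have sh: "?P s * tail_L (Suc r) a (shift_arg (of_nat k) s) = c k s * H (shift_arg (of_nat k) s)" for k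
        proof -
          have "pole_factor a 0 (shift_arg (of_nat k) s) = 1" using False by (simp add: pole_factor_def)
          thus ?thesis using shifted[OF s, of k] by simp
        qed
        have "(1 - a 0) * tail_L (Suc r) a s = a 0 * tail_L r (merge_base a) (merge_arg d s) -
            (\<Sum>k=1..Suc N. pochhammer (s 0) k / fact k * tail_L (Suc r) a (shift_arg (of_nat k) s)) - R s"
          using R(2)[OF s] unfolding d0 by (simp add: algebra_simps del: sum.cl_ivl_Suc)
        hence "?P s * ((1 - a 0) * tail_L (Suc r) a s) = a 0 * (?P s * tail_L r (merge_base a) (merge_arg d s)) -
            (\<Sum>k=1..Suc N. pochhammer (s 0) k / fact k * (?P s * tail_L (Suc r) a (shift_arg (of_nat k) s))) - ?P s * R s"
          by (simp only: right_diff_distrib sum_distrib_left) (simp add: mult_ac)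
        hence "inverse (1 - a 0) * (?P s * ((1 - a 0) * tail_L (Suc r) a s)) = G s"
          unfolding sh merged[OF s] G_def by simp
        moreover have "pole_factor a 0 s = 1" using False by (simp add: pole_factor_def)
        moreover have "inverse (1 - a 0) * (p * ((1 - a 0) * t)) = p * t" for p t
          using False by (simp add: field_simps)
        ultimately show ?thesis unfolding Q by (simp only: mult_1)
      qed
      ultimately show ?thesis by blast
    qed
  qed
qed

section \<open>Gluing the continuations on the exhausting domains\<close>

lemma separately_holo_UN:
  assumes "\<And>N. open (W N)" "\<And>N. separately_holo (W N) F"
  shows "separately_holo (\<Union>N. W N) F"
  unfolding separately_holo_def
proof (intro conjI ballI allI)
  show "continuous_on (\<Union>N. W N) F"
    using assms unfolding separately_holo_def by (intro continuous_on_open_UN) auto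
  fix s i assume "s \<in> (\<Union>N. W N)"
  let ?A = "{z. s(i := z) \<in> (\<Union>N. W N)}"
  have op: "open ?A" using assms by (intro open_slice) auto
  show "(\<lambda>z. F (s(i := z))) holomorphic_on ?A"
  proof (subst holomorphic_on_open[OF op], intro ballI)
    fix z assume "z \<in> ?A"
    then obtain N where N: "s(i := z) \<in> W N" by auto
    have "(\<lambda>w. F ((s(i := z))(i := w))) holomorphic_on {w. (s(i := z))(i := w) \<in> W N}"
      using assms(2)[of N] N unfolding separately_holo_def by blast
    hence "(\<lambda>w. F (s(i := w))) holomorphic_on {w. s(i := w) \<in> W N}" by simp
    thus "\<exists>f'. ((\<lambda>z. F (s(i := z))) has_field_derivative f') (at z)"
      using N holomorphic_on_open[OF open_slice[OF assms(1)], of _ s i N] by blast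
  qed
qed

lemma half_dom_exhausts: "\<exists>N. s \<in> half_dom r (real N)"
proof -
  have "\<forall>\<^sub>F N in sequentially. \<forall>i\<in>{..<r}. real i + 1 - Re (\<Sum>j\<le>i. s j) < real N"
    by (intro eventually_ball_finite ballI eventually_compose_filterlim[OF eventually_gt_at_top filterlim_real_sequentially]) auto
  then obtain N where "\<forall>i\<in>{..<r}. real i + 1 - Re (\<Sum>j\<le>i. s j) < real N"
    using eventually_happens' sequentially_bot by blast
  thus ?thesis unfolding half_dom_def by (intro exI[of _ N]) force
qed

text \<open>The identity theorem in the first variable alone is enough. Every partial sum contains
  \<open>s 0\<close>, so moving it to the right reaches the domain of convergence, and the slice is
  convex, hence connected.\<close>

lemma half_dom_identity:
  assumes F: "separately_holo (half_dom r N) F" and G: "separately_holo (half_dom r N) G"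
    and eq: "\<And>s. s \<in> half_dom r 0 \<Longrightarrow> F s = G s" and N: "N \<ge> 0" and s: "s \<in> half_dom r N"
  shows "F s = G s"
proof -
  define S where "S M = {z. s(0 := z) \<in> half_dom r M}" for M
  have S: "S M = {z. \<forall>i<r. real i + 1 - M + Re (s 0) - Re (\<Sum>j\<le>i. s j) < Re z}" for M
  proof -
    have "(\<Sum>j\<le>i. (s(0 := z)) j) = (\<Sum>j\<le>i. s j) + (z - s 0)" for i z
      using sum_shift_arg[of "z - s 0" s i] by (simp add: shift_arg_def)
    moreover have "c < Re (A + (z - s 0)) \<longleftrightarrow> c + Re (s 0) - Re A < Re z" for c A z by auto
    ultimately show ?thesis unfolding S_def half_dom_def mem_Collect_eq by (simp only:)
  qed
  have "convex (S N)"
  proof -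
    have "S N = (\<Inter>i\<in>{..<r}. {z. real i + 1 - N + Re (s 0) - Re (\<Sum>j\<le>i. s j) < Re z})" unfolding S by auto
    thus ?thesis by (auto intro!: convex_INT convex_halfspace_Re_gt)
  qed
  hence conn: "connected (S N)" by (rule convex_connected)
  have "\<exists>x. \<forall>i\<in>{..<r}. real i + 1 - 0 + Re (s 0) - Re (\<Sum>j\<le>i. s j) < x"
  proof -
    have "\<forall>\<^sub>F x in at_top. \<forall>i\<in>{..<r}. real i + 1 - 0 + Re (s 0) - Re (\<Sum>j\<le>i. s j) < x"
      by (intro eventually_ball_finite ballI eventually_gt_at_top) auto
    thus ?thesis using eventually_happens'[OF trivial_limit_at_top_linorder] by blast
  qed
  then obtain x where "\<forall>i\<in>{..<r}. real i + 1 - 0 + Re (s 0) - Re (\<Sum>j\<le>i. s j) < x" by blast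
  hence ne: "complex_of_real x \<in> S 0" unfolding S by auto
  have op: "open (S M)" for M unfolding S_def by (rule open_slice[OF open_half_dom])
  have "(\<lambda>z. F (s(0 := z))) holomorphic_on S N" "(\<lambda>z. G (s(0 := z))) holomorphic_on S N"
    using F G s unfolding separately_holo_def S_def by auto
  moreover have "S 0 \<subseteq> S N" using half_dom_mono[OF N] unfolding S_def by blast
  moreover have "s 0 \<in> S N" using s by (simp add: S_def)
  moreover have "F (s(0 := z)) = G (s(0 := z))" if "z \<in> S 0" for z using eq that by (simp add: S_def)
  ultimately have "F (s(0 := s 0)) = G (s(0 := s 0))"
    using analytic_continuation_open[of "S 0" "S N" "\<lambda>z. F (s(0 := z))" "\<lambda>z. G (s(0 := z))" "s 0"]
      op conn ne by blast
  thus ?thesis by simp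
qed

text \<open>Continuations for different \<open>N\<close> agree where both are defined, so the value
  at \<open>s\<close> can be taken from the least \<open>N\<close> whose domain contains
  \<open>s\<close>.\<close>

lemma tail_L_entire:
  assumes "\<And>i. i < r \<Longrightarrow> norm (\<Prod>j\<le>i. a j) \<le> 1"
  obtains H where "separately_holo UNIV H"
    "\<And>s. s \<in> half_dom r 0 \<Longrightarrow> H s = pole_prod r a s * tail_L r a s"
proof -
  have "\<forall>N. \<exists>H. separately_holo (half_dom r (real N)) H \<and>
    (\<forall>s\<in>half_dom r 0. H s = pole_prod r a s * tail_L r a s)"
    using tail_L_extends[of r a] assms by blast
  then obtain H where H: "\<And>N. separately_holo (half_dom r (real N)) (H N)"
    "\<And>N s. s \<in> half_dom r 0 \<Longrightarrow> H N s = pole_prod r a s * tail_L r a s" by metis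
  have coh: "H N s = H M s" if "s \<in> half_dom r (real N)" "N \<le> M" for N M s
    by (rule half_dom_identity[OF H(1) separately_holo_subset[OF H(1)[of M]] _ _ that(1)])
       (use that H(2) half_dom_mono in auto)
  define G where "G s = H (LEAST N. s \<in> half_dom r (real N)) s" for s
  have G: "G s = H N s" if "s \<in> half_dom r (real N)" for s N
    unfolding G_def by (rule coh) (use that in \<open>auto intro: LeastI Least_le\<close>)
  have "separately_holo (\<Union>N. half_dom r (real N)) G"
    by (intro separately_holo_UN open_half_dom separately_holo_cong[OF H(1)]) (simp add: G)
  moreover have "(\<Union>N. half_dom r (real N)) = UNIV" using half_dom_exhausts by blast
  moreover have "G s = pole_prod r a s * tail_L r a s" if "s \<in> half_dom r 0" for s
    using G[of s 0] H(2) that by simp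
  ultimately show ?thesis using that by metis
qed

section \<open>Identity theorem for meromorphic functions\<close>

lemma openin_Cn_box:
  "openin (Cn r) (\<Pi>\<^sub>E i\<in>{1..r}. ball (p i) e)"
  unfolding Cn_def by (simp add: openin_PiE_gen)

lemma topspace_Cn: "Cspace r = {1..r} \<rightarrow>\<^sub>E UNIV"
  unfolding Cn_def by simp

lemma openin_Cn_contains_box:
  assumes V: "openin (Cn r) V" and p: "p \<in> V"
  obtains e where "e > 0" "p \<in> (\<Pi>\<^sub>E i\<in>{1..r}. ball (p i) e)" "(\<Pi>\<^sub>E i\<in>{1..r}. ball (p i) e) \<subseteq> V"
proof -
  obtain U where U: "\<forall>i\<in>{1..r}. open (U i)" "p \<in> Pi\<^sub>E {1..r} U" "Pi\<^sub>E {1..r} U \<subseteq> V"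
  proof -
    from V p obtain U where "\<forall>i\<in>{1..r}. openin euclidean (U i)" "p \<in> Pi\<^sub>E {1..r} U" "Pi\<^sub>E {1..r} U \<subseteq> V"
      unfolding Cn_def openin_product_topology_alt by meson
    thus ?thesis using that[of U] by simp
  qed
  have "\<forall>\<^sub>F e in at_right 0. \<forall>i\<in>{1..r}. ball (p i) e \<subseteq> U i"
  proof (intro eventually_ball_finite ballI)
    fix i assume i: "i \<in> {1..r}"
    obtain d where d: "d > 0" "ball (p i) d \<subseteq> U i"
      by (rule openE[OF U(1)[rule_format, OF i] PiE_mem[OF U(2) i]])
    show "\<forall>\<^sub>F e in at_right 0. ball (p i) e \<subseteq> U i"
      unfolding eventually_at_right_field using d subset_ball[of _ d "p i"]
      by (intro exI[of _ d]) (auto simp: less_imp_le)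
  qed auto
  moreover have "\<forall>\<^sub>F e in at_right (0::real). 0 < e" by (rule eventually_at_right_less)
  ultimately have "\<forall>\<^sub>F e in at_right (0::real). 0 < e \<and> (\<forall>i\<in>{1..r}. ball (p i) e \<subseteq> U i)"
    by eventually_elim auto
  then obtain e where e: "e > 0" "\<forall>i\<in>{1..r}. ball (p i) e \<subseteq> U i"
    using eventually_happens[of _ "at_right (0::real)"] by force
  show ?thesis
  proof (rule that[OF e(1)])
    show "p \<in> (\<Pi>\<^sub>E i\<in>{1..r}. ball (p i) e)" using U(2) e(1) by (auto simp: PiE_iff)
    show "(\<Pi>\<^sub>E i\<in>{1..r}. ball (p i) e) \<subseteq> V" 
      by (rule order_trans[OF PiE_mono U(3)]) (use e(2) in blast)
  qed
qed

text \<open>One coordinate at a time, by the one-variable identity theorem on discs.\<close>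

lemma holomorphic_Cn_zero_on_box:
  assumes B: "B = (\<Pi>\<^sub>E i\<in>{1..r}. ball (p i) e)" and F: "holomorphic_Cn r B F"
    and D: "openin (Cn r) D" "D \<subseteq> B" "q \<in> D" and zero: "\<And>s. s \<in> D \<Longrightarrow> F s = 0" and s: "s \<in> B"
  shows "F s = 0"
proof -
  obtain d where d: "d > 0" "q \<in> (\<Pi>\<^sub>E i\<in>{1..r}. ball (q i) d)" "(\<Pi>\<^sub>E i\<in>{1..r}. ball (q i) d) \<subseteq> D"
    using openin_Cn_contains_box[OF D(1,3)] by blast
  have sub: "ball (q i) d \<subseteq> ball (p i) e" if i: "i \<in> {1..r}" for i
  proof
    fix z assume z: "z \<in> ball (q i) d"
    have "q(i := z) \<in> (\<Pi>\<^sub>E i\<in>{1..r}. ball (q i) d)" using d(1,2) z i by (auto simp: PiE_iff extensional_def)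
    hence "q(i := z) \<in> B" using d(3) D(2) by blast
    thus "z \<in> ball (p i) e" using i unfolding B by (auto dest!: PiE_mem[of _ _ _ i])
  qed
  \<comment> \<open>The first \<open>k\<close> coordinates range over the whole box while the others
    stay near \<open>q\<close>; each step of the induction frees one more.\<close>
  have "\<forall>s\<in>B. (\<forall>i\<in>{1..r}. i > k \<longrightarrow> s i \<in> ball (q i) d) \<longrightarrow> F s = 0" if "k \<le> r" for k
    using that
  proof (induction k)
    case 0
    show ?case
    proof (intro ballI impI)
      fix s assume "s \<in> B" "\<forall>i\<in>{1..r}. i > 0 \<longrightarrow> s i \<in> ball (q i) d"
      hence "s \<in> (\<Pi>\<^sub>E i\<in>{1..r}. ball (q i) d)" unfolding B by (auto simp: PiE_iff)
      thus "F s = 0" using d(3) zero by blast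
    qed
  next
    case (Suc k)
    show ?case
    proof (intro ballI impI)
      fix s assume s: "s \<in> B" and si: "\<forall>i\<in>{1..r}. i > Suc k \<longrightarrow> s i \<in> ball (q i) d"
      have k: "Suc k \<in> {1..r}" using Suc.prems by auto
      have eq: "{z. s(Suc k := z) \<in> B} = ball (p (Suc k)) e"
        using s k unfolding B by (auto simp: PiE_iff extensional_def)
      have holo: "(\<lambda>z. F (s(Suc k := z))) holomorphic_on ball (p (Suc k)) e"
        using F s k unfolding holomorphic_Cn_def by (metis eq)
      have z0: "F (s(Suc k := z)) = 0" if z: "z \<in> ball (q (Suc k)) d" for z
      proof -
        have "s(Suc k := z) \<in> B" using eq sub[OF k] z by blast
        moreover have "\<forall>i\<in>{1..r}. i > k \<longrightarrow> (s(Suc k := z)) i \<in> ball (q i) d" using si z by auto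
        ultimately show ?thesis using Suc by auto
      qed
      have "s (Suc k) \<in> ball (p (Suc k)) e" using s k unfolding B by auto
      moreover have "ball (q (Suc k)) d \<noteq> {}" using d(1) by simp
      ultimately have "F (s(Suc k := s (Suc k))) = 0"
        using analytic_continuation_open[OF open_ball open_ball _ connected_ball sub[OF k] holo
            holomorphic_on_const z0] by blast
      thus "F s = 0" by simp
    qed
  qed
  from this[of r] show ?thesis using s by auto
qed

lemma holomorphic_Cn_subset:
  assumes "holomorphic_Cn r V F" "openin (Cn r) W" "W \<subseteq> V"
  shows "holomorphic_Cn r W F"
  unfolding holomorphic_Cn_def
proof (intro conjI ballI assms(2))
  show "continuous_map (subtopology (Cn r) W) euclidean F"
    using assms unfolding holomorphic_Cn_def by (blast intro: continuous_map_from_subtopology_mono)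
  fix s i assume "s \<in> W" "i \<in> {1..r}"
  hence "(\<lambda>z. F (s(i := z))) holomorphic_on {z. s(i := z) \<in> V}"
    using assms unfolding holomorphic_Cn_def by blast
  thus "(\<lambda>z. F (s(i := z))) holomorphic_on {z. s(i := z) \<in> W}"
    by (rule holomorphic_on_subset) (use assms(3) in blast)
qed

lemma continuous_map_complex_mult:
  fixes f g :: "'a \<Rightarrow> complex"
  shows "continuous_map X euclidean f \<Longrightarrow> continuous_map X euclidean g \<Longrightarrow>
    continuous_map X euclidean (\<lambda>x. f x * g x)"
  by (simp add: continuous_map_atin tendsto_mult)

lemma holomorphic_Cn_mult:
  "holomorphic_Cn r V f \<Longrightarrow> holomorphic_Cn r V g \<Longrightarrow> holomorphic_Cn r V (\<lambda>s. f s * g s)"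
  unfolding holomorphic_Cn_def by (auto intro!: holomorphic_on_mult continuous_map_complex_mult)

lemma holomorphic_Cn_diff:
  "holomorphic_Cn r V f \<Longrightarrow> holomorphic_Cn r V g \<Longrightarrow> holomorphic_Cn r V (\<lambda>s. f s - g s)"
  unfolding holomorphic_Cn_def by (auto intro!: holomorphic_on_diff continuous_map_diff)

text \<open>The closure of the largest open set on which the equation holds is shown to be open;
  connectedness then makes it the whole space. Near a closure point \<open>F = g / h\<close>, and
  the holomorphic function \<open>Q g - h G\<close> vanishes on an open piece of a box, hence on the
  box.\<close>

lemma meromorphic_identity:
  assumes F: "meromorphic_Cn r F"
    and Q: "holomorphic_Cn r (Cspace r) Q" and G: "holomorphic_Cn r (Cspace r) G"
    and U: "openin (Cn r) U" "U \<noteq> {}" and eq: "\<And>s. s \<in> U \<Longrightarrow> Q s * F s = G s"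
  shows "generically r (Cspace r) (\<lambda>s. Q s * F s = G s)"
proof -
  define D where "D = \<Union>{W. openin (Cn r) W \<and> (\<forall>s\<in>W. Q s * F s = G s)}"
  have D_op: "openin (Cn r) D" unfolding D_def by (rule openin_Union) auto
  have D_eq: "Q s * F s = G s" if "s \<in> D" for s using that unfolding D_def by blast
  have D_max: "W \<subseteq> D" if "openin (Cn r) W" "\<And>s. s \<in> W \<Longrightarrow> Q s * F s = G s" for W
    unfolding D_def by (rule Union_upper) (use that in blast)
  let ?C = "Cn r closure_of D"
  have "openin (Cn r) ?C"
  proof (subst openin_subopen, intro ballI)
    fix p assume p: "p \<in> ?C"
    hence "p \<in> Cspace r" by (rule subsetD[OF closure_of_subset_topspace])
    then obtain V g h where V: "p \<in> V" "holomorphic_Cn r V g" "holomorphic_Cn r V h"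
      "generically r V (\<lambda>s. h s \<noteq> 0 \<and> F s = g s / h s)"
      using F unfolding meromorphic_Cn_def by blast
    obtain E where E: "openin (Cn r) E" "E \<subseteq> V" "V \<subseteq> Cn r closure_of E"
      "\<And>s. s \<in> E \<Longrightarrow> h s \<noteq> 0 \<and> F s = g s / h s"
      using V(4) unfolding generically_def by blast
    have V_op: "openin (Cn r) V" using V(2) unfolding holomorphic_Cn_def by blast
    obtain e where e: "e > 0" "p \<in> (\<Pi>\<^sub>E i\<in>{1..r}. ball (p i) e)" "(\<Pi>\<^sub>E i\<in>{1..r}. ball (p i) e) \<subseteq> V"
      using openin_Cn_contains_box[OF V_op V(1)] by blast
    define B where "B = (\<Pi>\<^sub>E i\<in>{1..r}. ball (p i) e)"
    have B: "openin (Cn r) B" "p \<in> B" "B \<subseteq> V" unfolding B_def using e openin_Cn_box by auto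
    have BC: "B \<subseteq> Cspace r" using B(1) openin_subset by blast
    have "B \<inter> D \<noteq> {}" using p B unfolding in_closure_of by blast
    then obtain q where "q \<in> B \<inter> D" by blast
    hence "q \<in> Cn r closure_of E" "openin (Cn r) (B \<inter> D)" "q \<in> B \<inter> D"
      using B E(3) D_op by auto
    then obtain q' where q': "q' \<in> E \<inter> (B \<inter> D)" unfolding in_closure_of by blast
    have zero: "Q s * g s - h s * G s = 0" if s: "s \<in> B" for s
    proof (rule holomorphic_Cn_zero_on_box[of B r p e _ "E \<inter> (B \<inter> D)" q', OF B_def _ _ _ q' _ s])
      show "holomorphic_Cn r B (\<lambda>s. Q s * g s - h s * G s)"
        by (intro holomorphic_Cn_diff holomorphic_Cn_mult) (use holomorphic_Cn_subset B(1,3) BC Q G V(2,3) in blast)+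
      show "openin (Cn r) (E \<inter> (B \<inter> D))" using E(1) B(1) D_op by auto
      show "Q s * g s - h s * G s = 0" if "s \<in> E \<inter> (B \<inter> D)" for s
        using E(4)[of s] D_eq[of s] that by (auto simp: field_simps)
    qed auto
    \<comment> \<open>On \<open>E\<close> the quotient representation is valid, so the equation
      returns to \<open>F\<close> there, and \<open>E\<close> is dense in the box.\<close>
    have "B \<inter> E \<subseteq> D"
    proof (rule D_max)
      show "openin (Cn r) (B \<inter> E)" using B(1) E(1) by auto
      show "Q s * F s = G s" if "s \<in> B \<inter> E" for s
        using zero[of s] E(4)[of s] that by (auto simp: field_simps)
    qed
    moreover have "B \<subseteq> Cn r closure_of (B \<inter> E)"
      using openin_Int_closure_of_subset[OF B(1), of E] B(3) E(3) by blast
    ultimately have "B \<subseteq> ?C" using closure_of_mono by blast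
    thus "\<exists>T. openin (Cn r) T \<and> p \<in> T \<and> T \<subseteq> ?C" using B by blast
  qed
  moreover have "closedin (Cn r) ?C" by simp
  moreover have "connected_space (Cn r)"
  proof -
    have "connected_space (euclidean :: complex topology)"
      by (metis connectedin_topspace connectedin_iff_connected connected_UNIV topspace_euclidean)
    thus ?thesis unfolding Cn_def by (simp add: connected_space_product_topology)
  qed
  moreover have "U \<subseteq> D" using D_max[OF U(1)] eq by blast
  hence "?C \<noteq> {}" using U closure_of_subset[of D "Cn r"] openin_subset[OF D_op] by blast
  ultimately have "?C = Cspace r" unfolding connected_space_clopen_in by blast
  thus ?thesis unfolding generically_def
    using D_op D_eq openin_subset[OF D_op] by (intro exI[of _ D]) auto
qed

section \<open>Passage from points of \<open>Cn r\<close> to sequences\<close>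

definition drop_arg :: "(nat \<Rightarrow> complex) \<Rightarrow> nat \<Rightarrow> complex" where
  "drop_arg s = (\<lambda>i. s (Suc i))"

text \<open>Beyond the last coordinate a point has the fixed value \<open>undefined\<close>, so
  these components are constant.\<close>

lemma continuous_map_drop_arg: "continuous_map (Cn r) euclidean drop_arg"
proof -
  have "continuous_map (Cn r) euclidean (\<lambda>s. drop_arg s i)" for i
  proof (cases "Suc i \<in> {1..r}")
    case True
    thus ?thesis unfolding Cn_def drop_arg_def by (rule continuous_map_product_projection)
  next
    case False
    show ?thesis
      by (rule continuous_map_eq[of _ _ "\<lambda>_. undefined"])
         (use False in \<open>auto simp: drop_arg_def topspace_Cn PiE_def extensional_def\<close>)
  qed
  hence "continuous_map (Cn r) (product_topology (\<lambda>_. euclidean) UNIV) drop_arg"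
    by (subst continuous_map_componentwise_UNIV) blast
  thus ?thesis by (simp add: euclidean_product_topology)
qed

lemma holomorphic_Cn_drop_arg:
  assumes H: "separately_holo W H" and U: "openin (Cn r) U" and sub: "\<And>s. s \<in> U \<Longrightarrow> drop_arg s \<in> W"
  shows "holomorphic_Cn r U (\<lambda>s. H (drop_arg s))"
  unfolding holomorphic_Cn_def
proof (intro conjI ballI U)
  have "continuous_map (subtopology (Cn r) U) (top_of_set W) drop_arg"
    using continuous_map_from_subtopology[OF continuous_map_drop_arg] sub openin_subset[OF U]
    by (auto simp: continuous_map_in_subtopology)
  moreover have "continuous_map (top_of_set W) euclidean H"
    using H unfolding separately_holo_def by simp
  ultimately show "continuous_map (subtopology (Cn r) U) euclidean (\<lambda>s. H (drop_arg s))"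
    using continuous_map_compose[of _ _ drop_arg _ H] by (auto simp: o_def)
  fix s i assume s: "s \<in> U" and i: "i \<in> {1..r}"
  have eq: "drop_arg (s(i := z)) = (drop_arg s)(i - 1 := z)" for z
    using i by (auto simp: drop_arg_def fun_eq_iff)
  have "(\<lambda>z. H ((drop_arg s)(i - 1 := z))) holomorphic_on {z. (drop_arg s)(i - 1 := z) \<in> W}"
    using H sub[OF s] unfolding separately_holo_def by blast
  thus "(\<lambda>z. H (drop_arg (s(i := z)))) holomorphic_on {z. s(i := z) \<in> U}"
    unfolding eq
  proof (rule holomorphic_on_subset, intro subsetI CollectI)
    fix z assume "z \<in> {z. s(i := z) \<in> U}"
    hence "drop_arg (s(i := z)) \<in> W" using sub by blast
    thus "(drop_arg s)(i - 1 := z) \<in> W" unfolding eq .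
  qed
qed

lemma separately_holo_divide:
  "separately_holo W F \<Longrightarrow> separately_holo W G \<Longrightarrow> (\<And>s. s \<in> W \<Longrightarrow> G s \<noteq> 0) \<Longrightarrow>
    separately_holo W (\<lambda>s. F s / G s)"
  unfolding separately_holo_def by (auto intro!: continuous_intros holomorphic_intros)

text \<open>
  The curve \<open>t \<mapsto> p + t v\<close>, where \<open>v\<close> has the prescribed partial sums \<open>w 0, w 1, \<dots>\<close>.
\<close>

definition perturb :: "nat \<Rightarrow> (nat \<Rightarrow> complex) \<Rightarrow> (nat \<Rightarrow> complex) \<Rightarrow> complex \<Rightarrow> nat \<Rightarrow> complex" where
  "perturb r w p t = (\<lambda>i\<in>{1..r}. p i + t * (w (i - 1) - (if i = 1 then 0 else w (i - 2))))"

lemma perturb_Cspace: "perturb r w p t \<in> Cspace r"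
  unfolding perturb_def topspace_Cn by auto

lemma perturb_0: "p \<in> Cspace r \<Longrightarrow> perturb r w p 0 = p"
  unfolding perturb_def topspace_Cn by (auto simp: fun_eq_iff PiE_def extensional_def)

lemma sum_perturb:
  "i < r \<Longrightarrow> (\<Sum>j\<le>i. drop_arg (perturb r w p t) j) = (\<Sum>j\<le>i. drop_arg p j) + t * w i"
proof (induction i)
  case (Suc i)
  hence "drop_arg (perturb r w p t) (Suc i) = drop_arg p (Suc i) + t * (w (Suc i) - w i)"
    by (simp add: drop_arg_def perturb_def)
  with Suc show ?case by (simp add: algebra_simps)
qed (auto simp: drop_arg_def perturb_def)

lemma eventually_perturb:
  assumes "openin (Cn r) U" "p \<in> U"
  shows "\<forall>\<^sub>F t in at 0. perturb r w p t \<in> U"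
proof -
  have pC: "p \<in> Cspace r" using assms openin_subset by blast
  have "continuous_map euclidean (Cn r) (perturb r w p)"
    unfolding Cn_def continuous_map_componentwise
    by (auto simp: perturb_def intro!: continuous_intros)
  hence "open {t. perturb r w p t \<in> U}"
    using assms(1) by (auto simp: continuous_map_def)
  moreover have "0 \<in> {t. perturb r w p t \<in> U}" using perturb_0[OF pC] assms(2) by simp
  ultimately have "\<forall>\<^sub>F t in nhds 0. t \<in> {t. perturb r w p t \<in> U}" by (rule eventually_nhds_in_open)
  thus ?thesis using eventually_nhds_conv_at by fastforce
qed

section \<open>The multiple additive L-function and its poles\<close>

lemma char_hom_of_nat:
  assumes "char_hom u"
  shows "u (int n) = u 1 ^ n"
proof (induction n)
  case 0
  have "u (0 + 0) = u 0 * u 0" "u 0 \<noteq> 0" using assms unfolding char_hom_def by blast+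
  thus ?case by simp
next
  case (Suc n)
  have "u (int n + 1) = u (int n) * u 1" using assms unfolding char_hom_def by blast
  thus ?case using Suc by (simp add: add.commute)
qed

text \<open>The value 1 from index \<open>r\<close> on makes the additional last factor of a depth
  \<open>r\<close> term trivial. At depth \<open>r - 1\<close> that factor is the genuine one of
  \<open>f r\<close> at \<open>n_r = 1\<close>.\<close>

definition base_seq :: "nat \<Rightarrow> (nat \<Rightarrow> int \<Rightarrow> complex) \<Rightarrow> nat \<Rightarrow> complex" where
  "base_seq r f = (\<lambda>i. if i < r then f (Suc i) 1 else 1)"

lemma prod_base_seq: "i < r \<Longrightarrow> (\<Prod>j\<le>i. base_seq r f j) = partial_prod f (Suc i) 1"
  unfolding partial_prod_def One_nat_def prod.atLeast1_atMost_eq lessThan_Suc_atMost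
  by (intro prod.cong) (auto simp: base_seq_def)

lemma sum_drop_arg: "(\<Sum>j\<le>i. drop_arg s j) = (\<Sum>j=1..Suc i. s j)"
  unfolding One_nat_def sum.atLeast1_atMost_eq lessThan_Suc_atMost drop_arg_def ..

lemma U_dom_eq: "U_dom r = {s \<in> Cspace r. drop_arg s \<in> half_dom r 0}"
proof -
  have "(\<forall>i\<in>{1..r}. Q i) \<longleftrightarrow> (\<forall>i<r. Q (Suc i))" for Q
  proof safe
    fix i assume "\<forall>i<r. Q (Suc i)" "i \<in> {1..r}"
    thus "Q i" by (cases i) auto
  qed auto
  hence "(\<forall>i\<in>{1..r}. Re (\<Sum>j=1..i. s j) > real i) \<longleftrightarrow> drop_arg s \<in> half_dom r 0" for s
    by (simp only: half_dom_def sum_drop_arg mem_Collect_eq of_nat_Suc diff_zero add.commute)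
  thus ?thesis unfolding U_dom_def by blast
qed

lemma openin_U_dom: "openin (Cn r) (U_dom r)"
proof -
  have "openin (Cn r) {s \<in> Cspace r. drop_arg s \<in> half_dom r 0}"
    using continuous_map_drop_arg[of r] open_half_dom[of r 0] unfolding continuous_map_def by auto
  thus ?thesis by (simp add: U_dom_eq)
qed

lemma U_dom_nonempty: "U_dom r \<noteq> {}"
proof -
  have "Re (\<Sum>j=1..i. (\<lambda>i\<in>{1..r}. 2) j) = 2 * real i" if "i \<in> {1..r}" for i
  proof -
    have "(\<Sum>j=1..i. (\<lambda>i\<in>{1..r}. 2) j) = (\<Sum>j=1..i. 2 :: complex)"
      using that by (intro sum.cong) auto
    thus ?thesis by simp
  qed
  hence "(\<lambda>i\<in>{1..r}. 2) \<in> U_dom r" unfolding U_dom_def topspace_Cn by auto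
  thus ?thesis by blast
qed

lemma bij_betw_decr_tuples:
  assumes "r \<ge> 1"
  shows "bij_betw (\<lambda>n i. if i < r then n (Suc i) else 1) (decr_tuples r)
    (desc_tails r \<union> desc_tails (r - 1))"
proof (rule bij_betwI[where g = "\<lambda>m. \<lambda>i\<in>{1..r}. m (i - 1)"])
  let ?f = "\<lambda>n i. if i < r then n (Suc i) else 1 :: nat"
  show "?f \<in> decr_tuples r \<rightarrow> desc_tails r \<union> desc_tails (r - 1)"
  proof
    fix n assume n: "n \<in> decr_tuples r"
    have ge: "n i \<ge> 1" if "i \<in> {1..r}" for i
      using n that unfolding decr_tuples_def by (auto dest!: PiE_mem)
    have less: "n (Suc i) < n i" if "1 \<le> i" "i < r" for i
      using n that unfolding decr_tuples_def by auto
    have "?f n \<in> desc_tails r" if "n r > 1"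
    proof -
      have "?f n (Suc i) < ?f n i" if i: "i < r" for i
        using less[of "Suc i"] \<open>n r > 1\<close> i by (cases "Suc i = r") auto
      thus ?thesis unfolding desc_tails_def by auto
    qed
    moreover have "?f n \<in> desc_tails (r - 1)" if "n r = 1"
    proof -
      have "?f n (Suc i) < ?f n i" if i: "i < r - 1" for i
        using less[of "Suc i"] i by auto
      moreover have "?f n i = 1" if "i \<ge> r - 1" for i
        using \<open>n r = 1\<close> that assms by (cases "Suc i = r") auto
      ultimately show ?thesis unfolding desc_tails_def by blast
    qed
    ultimately show "?f n \<in> desc_tails r \<union> desc_tails (r - 1)" using ge[of r] assms by fastforce
  qed
  show "(\<lambda>m. \<lambda>i\<in>{1..r}. m (i - 1)) \<in> desc_tails r \<union> desc_tails (r - 1) \<rightarrow> decr_tuples r"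
  proof
    fix m assume m: "m \<in> desc_tails r \<union> desc_tails (r - 1)"
    have "m i \<ge> 1" for i using m desc_tails_ge1 by blast
    moreover have "m i < m (i - 1)" if "i \<in> {1..<r}" for i
      using m that unfolding desc_tails_def by (cases i) auto
    ultimately show "(\<lambda>i\<in>{1..r}. m (i - 1)) \<in> decr_tuples r" unfolding decr_tuples_def by auto
  qed
  show "(\<lambda>i\<in>{1..r}. ?f n (i - 1)) = n" if "n \<in> decr_tuples r" for n
    using that unfolding decr_tuples_def by (auto simp: fun_eq_iff PiE_def extensional_def)
  show "?f (\<lambda>i\<in>{1..r}. m (i - 1)) = m" if "m \<in> desc_tails r \<union> desc_tails (r - 1)" for m
    using that unfolding desc_tails_def by (auto simp: fun_eq_iff)
qed

text \<open>The tuples with \<open>n\<^sub>r > 1\<close> and with \<open>n\<^sub>r = 1\<close>, respectively, give the two summands.\<close>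

lemma mult_L_eq_tail_L:
  assumes r: "r \<ge> 1" and f: "\<forall>i\<in>{1..r}. char_hom (f i)"
    and g: "\<forall>i\<in>{1..r}. norm (partial_prod f i 1) \<le> 1" and s: "s \<in> U_dom r"
  shows "mult_L r f s = tail_L r (base_seq r f) (drop_arg s) + tail_L (r - 1) (base_seq r f) (drop_arg s)"
proof -
  define b where "b = base_seq r f"
  define T where "T m = (\<Prod>i<r. b i ^ m i * of_nat (m i) powr (- drop_arg s i))" for m
  have b: "norm (\<Prod>j\<le>i. b j) \<le> 1" if "i < r" for i
    unfolding b_def prod_base_seq[OF that] using g that by auto
  have s': "drop_arg s \<in> half_dom r 0" using s by (simp add: U_dom_eq)
  have T1: "tail_term r b (drop_arg s) m = T m" if "m \<in> desc_tails r" for m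
    using that unfolding tail_term_def T_def lessThan_Suc_atMost[symmetric]
    by (simp add: b_def base_seq_def desc_tails_def)
  have T2: "tail_term (r - 1) b (drop_arg s) m = T m" for m
    unfolding tail_term_def T_def lessThan_Suc_atMost[symmetric] using r by simp
  have s1: "T summable_on desc_tails r"
    using tail_term_summable_and_holo(2)[OF b s'] T1 summable_on_cong by blast
  have s2: "T summable_on desc_tails (r - 1)"
    using tail_term_summable_and_holo(2)[of "r - 1" b "drop_arg s"] b s' half_dom_anti[of "r - 1" r 0]
    unfolding T2[abs_def] by auto
  have "m (r - 1) > 1" if "m \<in> desc_tails r" for m
    using desc_tails_ge2[OF that, of "r - 1"] r by simp
  moreover have "m (r - 1) = 1" if "m \<in> desc_tails (r - 1)" for m
    using that unfolding desc_tails_def by simp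
  ultimately have disj: "desc_tails r \<inter> desc_tails (r - 1) = {}"
    by (metis Int_iff equals0I less_irrefl)
  have "mult_L r f s = (\<Sum>\<^sub>\<infinity>n\<in>decr_tuples r. T (\<lambda>i. if i < r then n (Suc i) else 1))"
    unfolding mult_L_def
  proof (rule infsum_cong)
    fix n assume "n \<in> decr_tuples r"
    show "(\<Prod>i=1..r. f i (int (n i)) / of_nat (n i) powr s i) = T (\<lambda>i. if i < r then n (Suc i) else 1)"
      unfolding T_def One_nat_def prod.atLeast1_atMost_eq
    proof (rule prod.cong[OF refl])
      fix i assume "i \<in> {..<r}"
      hence "char_hom (f (Suc i))" "i < r" using f by auto
      thus "f (Suc i) (int (n (Suc i))) / of_nat (n (Suc i)) powr s (Suc i) =
          b i ^ (if i < r then n (Suc i) else Suc 0) *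
          of_nat (if i < r then n (Suc i) else Suc 0) powr (- drop_arg s i)"
        by (simp add: char_hom_of_nat b_def base_seq_def drop_arg_def powr_minus divide_inverse)
    qed
  qed
  also have "\<dots> = infsum T (desc_tails r \<union> desc_tails (r - 1))"
    by (rule infsum_reindex_bij_betw[OF bij_betw_decr_tuples[OF r]])
  also have "\<dots> = infsum T (desc_tails r) + infsum T (desc_tails (r - 1))"
    by (rule infsum_Un_disjoint[OF s1 s2 disj])
  also have "infsum T (desc_tails r) = tail_L r b (drop_arg s)"
    unfolding tail_L_def by (rule infsum_cong) (simp add: T1)
  also have "infsum T (desc_tails (r - 1)) = tail_L (r - 1) b (drop_arg s)"
    unfolding tail_L_def by (rule infsum_cong) (rule T2[symmetric])
  finally show ?thesis by (simp add: b_def)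
qed

text \<open>The part of depth \<open>r - 1\<close> is cleared by the first \<open>r - 1\<close>
  factors; the last factor is carried along as an entire multiplier.\<close>

lemma mult_L_entire:
  assumes r: "r \<ge> 1" and f: "\<forall>i\<in>{1..r}. char_hom (f i)"
    and g: "\<forall>i\<in>{1..r}. norm (partial_prod f i 1) \<le> 1"
  obtains G where "separately_holo UNIV G"
    "\<And>s. s \<in> U_dom r \<Longrightarrow> pole_prod r (base_seq r f) (drop_arg s) * mult_L r f s = G (drop_arg s)"
proof -
  define b where "b = base_seq r f"
  have b: "norm (\<Prod>j\<le>i. b j) \<le> 1" if "i < r" for i
    unfolding b_def prod_base_seq[OF that] using g that by auto
  obtain H where H: "separately_holo UNIV H"
    "\<And>s. s \<in> half_dom r 0 \<Longrightarrow> H s = pole_prod r b s * tail_L r b s"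
    using tail_L_entire[of r b] b by blast
  obtain H' where H': "separately_holo UNIV H'"
    "\<And>s. s \<in> half_dom (r - 1) 0 \<Longrightarrow> H' s = pole_prod (r - 1) b s * tail_L (r - 1) b s"
    using tail_L_entire[of "r - 1" b] b by auto
  have Q: "pole_prod r b s = pole_prod (r - 1) b s * pole_factor b (r - 1) s" for s
    using r unfolding pole_prod_def by (cases r) auto
  show ?thesis
  proof (rule that[of "\<lambda>s. H s + pole_factor b (r - 1) s * H' s"])
    show "separately_holo UNIV (\<lambda>s. H s + pole_factor b (r - 1) s * H' s)"
      by (intro separately_holo_add separately_holo_mult H(1) H'(1) separately_holo_pole_factor)
    fix s assume s: "s \<in> U_dom r"
    hence "drop_arg s \<in> half_dom r 0" "drop_arg s \<in> half_dom (r - 1) 0"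
      using half_dom_anti[of "r - 1" r 0] by (auto simp: U_dom_eq)
    thus "pole_prod r (base_seq r f) (drop_arg s) * mult_L r f s =
        H (drop_arg s) + pole_factor b (r - 1) (drop_arg s) * H' (drop_arg s)"
      using mult_L_eq_tail_L[OF assms s]
      by (simp add: H(2) H'(2) Q algebra_simps flip: b_def)
  qed
qed

section \<open>Zeros of the clearing factors, as functions of one partial sum\<close>

definition pole_fun :: "(nat \<Rightarrow> complex) \<Rightarrow> nat \<Rightarrow> complex \<Rightarrow> complex" where
  "pole_fun a i z = (if (\<Prod>l\<le>i. a l) \<noteq> 1 then 1 else if i = 0 then z - 1
     else rGamma (z - of_nat (pole_count a i)))"

lemma pole_factor_eq: "pole_factor a i s = pole_fun a i (\<Sum>j\<le>i. s j)"
  unfolding pole_factor_def pole_fun_def by auto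

lemma holomorphic_pole_fun: "pole_fun a i holomorphic_on A"
proof -
  have "(\<lambda>z. rGamma (z - of_nat (pole_count a i))) holomorphic_on A"
    by (intro holomorphic_rGamma' holomorphic_intros)
  moreover have "(\<lambda>z. z - 1 :: complex) holomorphic_on A" by (intro holomorphic_intros)
  ultimately show ?thesis unfolding pole_fun_def[abs_def]
    by (cases "(\<Prod>l\<le>i. a l) = 1"; cases "i = 0") simp_all
qed

lemma pole_fun_eq_0_iff:
  "pole_fun a i z = 0 \<longleftrightarrow> (\<Prod>l\<le>i. a l) = 1 \<and>
     (if i = 0 then z = 1 else \<exists>n \<le> int (pole_count a i). z = of_int n)"
proof -
  have "rGamma (z - of_nat d) = 0 \<longleftrightarrow> (\<exists>n\<le>int d. z = of_int n)" for d :: nat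
  proof
    assume "rGamma (z - of_nat d) = 0"
    then obtain n where "n \<le> 0" "z - of_nat d = of_int n"
      unfolding rGamma_eq_zero_iff by (elim nonpos_Ints_cases)
    thus "\<exists>n\<le>int d. z = of_int n" by (intro exI[of _ "n + int d"]) (auto simp: algebra_simps)
  next
    assume "\<exists>n\<le>int d. z = of_int n"
    then obtain n where "n \<le> int d" "z = of_int n" by blast
    thus "rGamma (z - of_nat d) = 0" unfolding rGamma_eq_zero_iff nonpos_Ints_def
      by (intro CollectI exI[of _ "n - int d"]) auto
  qed
  thus ?thesis unfolding pole_fun_def by auto
qed

lemma pole_fun_nonzero_near: "\<forall>\<^sub>F t in at 0. pole_fun a i (c + t) \<noteq> 0"
proof -
  \<comment> \<open>Any point off the zeros serves the identity theorem: at 2 the linear factor is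
    1, and in the other case the argument of \<open>rGamma\<close> becomes 1.\<close>
  define \<beta> :: complex where "\<beta> = (if i = 0 then 2 else of_nat (pole_count a i) + 1)"
  have "pole_fun a i \<beta> \<noteq> 0" unfolding pole_fun_def \<beta>_def by auto
  from non_zero_neighbour_alt[OF holomorphic_pole_fun open_UNIV connected_UNIV UNIV_I UNIV_I this, of c]
  have "\<forall>\<^sub>F w in at c. pole_fun a i w \<noteq> 0" by simp
  thus ?thesis by (subst (asm) eventually_at_to_0) (simp add: add.commute)
qed

text \<open>\<open>m\<close> steps of the functional equation move the zero at \<open>n\<close> to
  the origin, and one more extracts the linear factor. At \<open>z = n\<close> the cofactor is
  \<open>pochhammer (- m) m * rGamma 1\<close>, and neither factor vanishes.\<close>

lemma pole_fun_simple_zero: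
  assumes "(\<Prod>l\<le>i. a l) = 1" "i = 0 \<and> n = 1 \<or> i \<noteq> 0 \<and> n \<le> int (pole_count a i)"
  obtains E where "E holomorphic_on UNIV" "E (of_int n) \<noteq> 0"
    "\<And>z. pole_fun a i z = (z - of_int n) * E z"
proof (cases "i = 0")
  case True
  thus ?thesis using assms by (intro that[of "\<lambda>_. 1"]) (auto simp: pole_fun_def)
next
  case False
  define d where "d = pole_count a i"
  define m where "m = nat (int d - n)"
  have m: "of_int n = (of_nat d - of_nat m :: complex)"
  proof -
    have "n = int d - int m" using assms False by (simp add: m_def d_def)
    thus ?thesis by simp
  qed
  let ?E = "\<lambda>z :: complex. pochhammer (z - of_nat d) m * rGamma (z - of_int n + 1)"
  have "?E holomorphic_on UNIV" by (intro holomorphic_intros holomorphic_rGamma')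
  moreover have "?E (of_int n) \<noteq> 0"
  proof -
    have "of_int n - of_nat d = - (of_nat m :: complex)" using m by simp
    thus ?thesis by (simp add: pochhammer_eq_0_iff)
  qed
  moreover have "pole_fun a i z = (z - of_int n) * ?E z" for z
  proof -
    have "rGamma (z - of_nat d) = pochhammer (z - of_nat d) m * rGamma (z - of_nat d + of_nat m)"
      by (rule pochhammer_rGamma)
    also have "z - of_nat d + of_nat m = z - of_int n" by (simp add: m)
    also have "rGamma (z - of_int n) = (z - of_int n) * rGamma (z - of_int n + 1)"
      by (rule rGamma_plus1[symmetric])
    finally show ?thesis using assms False unfolding pole_fun_def d_def by simp
  qed
  ultimately show ?thesis by (rule that)
qed

lemma pole_prod_eq: "pole_prod r a s = (\<Prod>i<r. pole_fun a i (\<Sum>j\<le>i. s j))"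
  unfolding pole_prod_def pole_factor_eq ..

text \<open>Where \<open>w i = 1\<close>, the \<open>i\<close>-th partial sum moves at unit speed
  along the curve, so each of the finitely many factors leaves its isolated zeros.\<close>

lemma perturb_prod_nonzero:
  assumes "p \<in> Cspace r" "I \<subseteq> {..<r}" "\<And>i. i \<in> I \<Longrightarrow> w i = 1"
  shows "\<forall>\<^sub>F t in at 0. (\<Prod>i\<in>I. pole_fun a i (\<Sum>j\<le>i. drop_arg (perturb r w p t) j)) \<noteq> 0"
proof -
  have "finite I" using assms(2) finite_subset by blast
  have "\<forall>\<^sub>F t in at 0. \<forall>i\<in>I. pole_fun a i ((\<Sum>j\<le>i. drop_arg p j) + t) \<noteq> 0"
    by (intro eventually_ball_finite \<open>finite I\<close> ballI pole_fun_nonzero_near)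
  thus ?thesis
  proof eventually_elim
    case (elim t)
    have "pole_fun a i (\<Sum>j\<le>i. drop_arg (perturb r w p t) j) \<noteq> 0" if "i \<in> I" for i
      using elim that assms(2,3) sum_perturb[of i r w p t] by auto
    thus ?case using \<open>finite I\<close> by simp
  qed
qed

lemma holomorphic_Cn_entire:
  "separately_holo UNIV H \<Longrightarrow> holomorphic_Cn r (Cspace r) (\<lambda>s. H (drop_arg s))"
  by (rule holomorphic_Cn_drop_arg) auto

lemma openin_pole_prod_nonzero: "openin (Cn r) {s \<in> Cspace r. pole_prod r a (drop_arg s) \<noteq> 0}"
proof -
  have "continuous_map (Cn r) euclidean (\<lambda>s. pole_prod r a (drop_arg s))"
    using holomorphic_Cn_entire[OF separately_holo_pole_prod[of UNIV r a], of r]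
    unfolding holomorphic_Cn_def by simp
  moreover have "open (- {0 :: complex})" by auto
  ultimately have "openin (Cn r) {s \<in> Cspace r. pole_prod r a (drop_arg s) \<in> - {0}}"
    unfolding continuous_map_def by auto
  thus ?thesis by simp
qed

lemma pole_prod_dense:
  "Cspace r \<subseteq> Cn r closure_of {s \<in> Cspace r. pole_prod r a (drop_arg s) \<noteq> 0}"
proof
  fix p assume p: "p \<in> Cspace r"
  show "p \<in> Cn r closure_of {s \<in> Cspace r. pole_prod r a (drop_arg s) \<noteq> 0}"
    unfolding in_closure_of
  proof (intro conjI p allI impI)
    fix U assume "p \<in> U \<and> openin (Cn r) U"
    hence "\<forall>\<^sub>F t in at 0. perturb r (\<lambda>_. 1) p t \<in> U" by (intro eventually_perturb) auto
    moreover have "\<forall>\<^sub>F t in at 0. pole_prod r a (drop_arg (perturb r (\<lambda>_. 1) p t)) \<noteq> 0"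
      unfolding pole_prod_eq by (rule perturb_prod_nonzero[OF p]) auto
    ultimately have "\<forall>\<^sub>F t in at 0. perturb r (\<lambda>_. 1) p t \<in> U \<and>
        pole_prod r a (drop_arg (perturb r (\<lambda>_. 1) p t)) \<noteq> 0" by (rule eventually_conj)
    then obtain t where "perturb r (\<lambda>_. 1) p t \<in> U"
      "pole_prod r a (drop_arg (perturb r (\<lambda>_. 1) p t)) \<noteq> 0"
      using eventually_happens' at_neq_bot by blast
    thus "\<exists>y. y \<in> {s \<in> Cspace r. pole_prod r a (drop_arg s) \<noteq> 0} \<and> y \<in> U"
      using perturb_Cspace by blast
  qed
qed

lemma generically_restrict:
  assumes "generically r (Cspace r) P" "openin (Cn r) W" "\<And>s. s \<in> W \<Longrightarrow> P s \<Longrightarrow> P' s"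
  shows "generically r W P'"
proof -
  obtain D where D: "openin (Cn r) D" "Cspace r \<subseteq> Cn r closure_of D" "\<And>s. s \<in> D \<Longrightarrow> P s"
    using assms(1) unfolding generically_def by blast
  have "W \<subseteq> Cn r closure_of (W \<inter> D)"
    using openin_Int_closure_of_subset[OF assms(2), of D] D(2) openin_subset[OF assms(2)] by blast
  thus ?thesis unfolding generically_def using D assms(2,3)
    by (intro exI[of _ "W \<inter> D"]) auto
qed

lemma mero_holomorphic_on_off_poles:
  assumes gen: "generically r (Cspace r) (\<lambda>s. pole_prod r a (drop_arg s) * F s = G (drop_arg s))"
    and G: "separately_holo UNIV G"
    and W: "W = {s \<in> Cspace r. pole_prod r a (drop_arg s) \<noteq> 0}"
  shows "mero_holomorphic_on r F W"
proof -
  let ?S = "{s. pole_prod r a s \<noteq> 0}"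
  have "separately_holo ?S (\<lambda>s. G s / pole_prod r a s)"
    using G separately_holo_subset
    by (intro separately_holo_divide separately_holo_pole_prod) auto
  hence "holomorphic_Cn r W (\<lambda>s. G (drop_arg s) / pole_prod r a (drop_arg s))"
    by (rule holomorphic_Cn_drop_arg) (auto simp: W openin_pole_prod_nonzero)
  moreover have "generically r W (\<lambda>s. F s = G (drop_arg s) / pole_prod r a (drop_arg s))"
    by (rule generically_restrict[OF gen]) (auto simp: W openin_pole_prod_nonzero field_simps)
  ultimately show ?thesis unfolding mero_holomorphic_on_def by blast
qed

text \<open>The cleared denominator is the affine form times \<open>h\<close>, globally, so one
  neighbourhood, the whole space, serves all points. It remains to see that \<open>h\<close> is
  nonzero on a dense part of the hyperplane.\<close>

lemma simple_pole_along:
  assumes gen: "generically r (Cspace r) (\<lambda>s. pole_prod r a (drop_arg s) * F s = G (drop_arg s))"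
    and G: "separately_holo UNIV G"
    and i: "i < r" "(\<Prod>l\<le>i. a l) = 1" "i = 0 \<and> n = 1 \<or> i \<noteq> 0 \<and> n \<le> int (pole_count a i)"
  shows "at_most_simple_pole_along r F (Suc i) n"
proof -
  obtain E where E: "E holomorphic_on UNIV" "E (of_int n) \<noteq> 0"
    "\<And>z. pole_fun a i z = (z - of_int n) * E z"
    using pole_fun_simple_zero[OF i(2,3)] by blast
  define h where "h s = E (\<Sum>j\<le>i. s j) * (\<Prod>k\<in>{..<r} - {i}. pole_fun a k (\<Sum>j\<le>k. s j))" for s
  have "separately_holo UNIV h" unfolding h_def[abs_def]
    by (intro separately_holo_mult separately_holo_prod separately_holo_entire[OF separately_holo_sum]
        separately_holo_coord E(1) holomorphic_pole_fun)
  hence h: "holomorphic_Cn r (Cspace r) (\<lambda>s. h (drop_arg s))" by (rule holomorphic_Cn_entire)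
  have form: "partial_sum_form (Suc i) n s = (\<Sum>j\<le>i. drop_arg s j) - of_int n" for s
    unfolding partial_sum_form_def sum_drop_arg ..
  have fac: "partial_sum_form (Suc i) n s * h (drop_arg s) = pole_prod r a (drop_arg s)" for s
    unfolding pole_prod_eq form h_def prod.remove[of "{..<r}" i, simplified, OF i(1)] E(3)
    by simp
  let ?P = "hyperplane r (Suc i) n"
  have dense: "Cspace r \<inter> ?P \<subseteq> Cn r closure_of {s \<in> Cspace r \<inter> ?P. h (drop_arg s) \<noteq> 0}"
  proof
    fix p assume "p \<in> Cspace r \<inter> ?P"
    hence p: "p \<in> Cspace r" "(\<Sum>j\<le>i. drop_arg p j) = of_int n"
      unfolding hyperplane_def form by auto
    \<comment> \<open>Keeping the \<open>i\<close>-th partial sum fixed and moving all others stays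
      on the hyperplane while leaving the zeros of the remaining factors.\<close>
    define w :: "nat \<Rightarrow> complex" where "w k = (if k = i then 0 else 1)" for k
    show "p \<in> Cn r closure_of {s \<in> Cspace r \<inter> ?P. h (drop_arg s) \<noteq> 0}"
      unfolding in_closure_of
    proof (intro conjI p(1) allI impI)
      fix U assume "p \<in> U \<and> openin (Cn r) U"
      hence "\<forall>\<^sub>F t in at 0. perturb r w p t \<in> U" by (intro eventually_perturb) auto
      moreover have "\<forall>\<^sub>F t in at 0. (\<Prod>k\<in>{..<r} - {i}. pole_fun a k
          (\<Sum>j\<le>k. drop_arg (perturb r w p t) j)) \<noteq> 0"
        by (rule perturb_prod_nonzero[OF p(1)]) (auto simp: w_def)
      ultimately have "\<forall>\<^sub>F t in at 0. perturb r w p t \<in> U \<and> (\<Prod>k\<in>{..<r} - {i}. pole_fun a k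
          (\<Sum>j\<le>k. drop_arg (perturb r w p t) j)) \<noteq> 0" by (rule eventually_conj)
      then obtain t where t: "perturb r w p t \<in> U" "(\<Prod>k\<in>{..<r} - {i}. pole_fun a k
          (\<Sum>j\<le>k. drop_arg (perturb r w p t) j)) \<noteq> 0"
        using eventually_happens' at_neq_bot by blast
      have "(\<Sum>j\<le>i. drop_arg (perturb r w p t) j) = of_int n"
        using sum_perturb[OF i(1), of w p t] p(2) by (simp add: w_def)
      hence "perturb r w p t \<in> ?P" "h (drop_arg (perturb r w p t)) \<noteq> 0"
        using t(2) E(2) perturb_Cspace unfolding hyperplane_def form h_def by auto
      thus "\<exists>y. y \<in> {s \<in> Cspace r \<inter> ?P. h (drop_arg s) \<noteq> 0} \<and> y \<in> U"
        using t(1) perturb_Cspace by blast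
    qed
  qed
  have "generically r (Cspace r) (\<lambda>s. partial_sum_form (Suc i) n s * h (drop_arg s) * F s = G (drop_arg s))"
    using gen by (simp add: fac)
  thus ?thesis unfolding at_most_simple_pole_along_def
    using h holomorphic_Cn_entire[OF G] dense unfolding hyperplane_def by blast
qed

section \<open>Existence and uniqueness of the continuation\<close>

lemma mult_L_has_continuation:
  assumes r: "r \<ge> 1" and f: "\<forall>i\<in>{1..r}. char_hom (f i)"
    and g: "\<forall>i\<in>{1..r}. norm (partial_prod f i 1) \<le> 1"
  shows "\<exists>F. meromorphic_continuation r f F"
proof -
  obtain G where G: "separately_holo UNIV G"
    "\<And>s. s \<in> U_dom r \<Longrightarrow> pole_prod r (base_seq r f) (drop_arg s) * mult_L r f s = G (drop_arg s)"
    using mult_L_entire[OF assms] by blast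
  let ?Q = "\<lambda>s. pole_prod r (base_seq r f) (drop_arg s)"
  \<comment> \<open>The first branch gives agreement with the series at every point of
    \<open>U_dom r\<close> by definition; wherever \<open>?Q\<close> is nonzero, both branches equal
    the quotient.\<close>
  define F where "F s = (if s \<in> U_dom r then mult_L r f s else G (drop_arg s) / ?Q s)" for s
  have "F s = G (drop_arg s) / ?Q s" if "?Q s \<noteq> 0" for s
    using that G(2)[of s] unfolding F_def by (auto simp: field_simps)
  hence "generically r (Cspace r) (\<lambda>s. ?Q s \<noteq> 0 \<and> F s = G (drop_arg s) / ?Q s)"
    unfolding generically_def using openin_pole_prod_nonzero pole_prod_dense
    by (intro exI[of _ "{s \<in> Cspace r. ?Q s \<noteq> 0}"]) auto
  hence "meromorphic_Cn r F" unfolding meromorphic_Cn_def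
    using holomorphic_Cn_entire[OF G(1), of r] holomorphic_Cn_entire[OF separately_holo_pole_prod, of r r "base_seq r f"]
    by blast
  thus ?thesis unfolding meromorphic_continuation_def by (intro exI[of _ F]) (auto simp: F_def)
qed

text \<open>Uniqueness enters here: the cleared equation spreads from \<open>U_dom r\<close> to an
  open dense set for every representative \<open>F\<close>.\<close>

lemma mult_L_continuation_generic:
  assumes r: "r \<ge> 1" and f: "\<forall>i\<in>{1..r}. char_hom (f i)"
    and g: "\<forall>i\<in>{1..r}. norm (partial_prod f i 1) \<le> 1"
    and F: "meromorphic_continuation r f F"
  obtains G where "separately_holo UNIV G"
    "generically r (Cspace r) (\<lambda>s. pole_prod r (base_seq r f) (drop_arg s) * F s = G (drop_arg s))"
proof -
  obtain G where G: "separately_holo UNIV G"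
    "\<And>s. s \<in> U_dom r \<Longrightarrow> pole_prod r (base_seq r f) (drop_arg s) * mult_L r f s = G (drop_arg s)"
    using mult_L_entire[OF r f g] by blast
  have "generically r (Cspace r) (\<lambda>s. pole_prod r (base_seq r f) (drop_arg s) * F s = G (drop_arg s))"
    using F G(2) unfolding meromorphic_continuation_def
    by (intro meromorphic_identity[OF _ _ _ openin_U_dom U_dom_nonempty] holomorphic_Cn_entire G(1)
        separately_holo_pole_prod) auto
  with G(1) show ?thesis by (rule that)
qed

lemma pole_count_base_seq:
  "i < r \<Longrightarrow> pole_count (base_seq r f) i = card {j \<in> {1..Suc i}. partial_prod f j 1 = 1}"
proof -
  assume i: "i < r"
  have "{j \<in> {1..Suc i}. partial_prod f j 1 = 1} = Suc ` {j. j \<le> i \<and> (\<Prod>l\<le>j. base_seq r f l) = 1}"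
  proof (intro set_eqI iffI)
    fix x assume "x \<in> {j \<in> {1..Suc i}. partial_prod f j 1 = 1}"
    thus "x \<in> Suc ` {j. j \<le> i \<and> (\<Prod>l\<le>j. base_seq r f l) = 1}"
      using i by (intro image_eqI[of _ _ "x - 1"]) (auto simp: prod_base_seq)
  qed (use i in \<open>auto simp: prod_base_seq\<close>)
  thus ?thesis unfolding pole_count_def by (simp add: card_image)
qed

text \<open>This identifies the pole count at the index \<open>idx j\<close> with \<open>j\<close>,
  the origin of the bound \<open>n \<le> j\<close> in the theorem.\<close>

lemma strict_mono_index_count:
  fixes idx :: "nat \<Rightarrow> nat"
  assumes idx: "strict_mono_on {1..m} idx" and im: "idx ` {1..m} = {i \<in> {1..r}. P i}" and j: "j \<in> {1..m}"
  shows "card {i \<in> {1..idx j}. P i} = j"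
proof -
  have le: "idx k \<le> idx j \<longleftrightarrow> k \<le> j" if "k \<in> {1..m}" for k
    using strict_mono_on_leD[OF idx] strict_mono_onD[OF idx] that j
    by (meson linorder_not_le)
  have "idx j \<le> r" using im j by auto
  hence "{i \<in> {1..idx j}. P i} = {i \<in> idx ` {1..m}. i \<le> idx j}" unfolding im by auto
  also have "\<dots> = idx ` {1..j}" using le j by auto
  also have "card \<dots> = j"
    using strict_mono_on_imp_inj_on[OF idx] j by (subst card_image) (auto intro: inj_on_subset)
  finally show ?thesis .
qed

theorem theorem6p1:
  fixes r :: nat and f :: "nat \<Rightarrow> int \<Rightarrow> complex"
  assumes "r \<ge> 1"
    and "\<forall>i\<in>{1..r}. char_hom (f i)"
    and "\<forall>i\<in>{1..r}. norm (partial_prod f i 1) \<le> 1"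
  shows "(\<exists>F. meromorphic_continuation r f F) \<and>
    (\<forall>F. meromorphic_continuation r f F \<longrightarrow>
      ((\<forall>i\<in>{1..r}. partial_prod f i 1 \<noteq> 1) \<longrightarrow> mero_holomorphic_on r F (Cspace r)) \<and>
      (\<forall>(m::nat) (idx::nat \<Rightarrow> nat).
         m \<ge> 1 \<and> strict_mono_on {1..m} idx \<and>
         idx ` {1..m} = {i\<in>{1..r}. partial_prod f i 1 = 1} \<longrightarrow>
           (idx 1 = 1 \<longrightarrow>
              holomorphic_with_simple_poles r F
                ({(1, 1)} \<union> {(idx j, n) | j n. 2 \<le> j \<and> j \<le> m \<and> n \<le> int j})) \<and>
           (idx 1 \<noteq> 1 \<longrightarrow>
              holomorphic_with_simple_poles r F
                {(idx j, n) | j n. 1 \<le> j \<and> j \<le> m \<and> n \<le> int j})))"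
proof (intro conjI allI impI)
  show "\<exists>F. meromorphic_continuation r f F" by (rule mult_L_has_continuation[OF assms])
next
  fix F assume F: "meromorphic_continuation r f F" and ne: "\<forall>i\<in>{1..r}. partial_prod f i 1 \<noteq> 1"
  obtain G where G: "separately_holo UNIV G"
    "generically r (Cspace r) (\<lambda>s. pole_prod r (base_seq r f) (drop_arg s) * F s = G (drop_arg s))"
    using mult_L_continuation_generic[OF assms F] by blast
  have "pole_fun (base_seq r f) i z \<noteq> 0" if "i < r" for i z
    using ne that unfolding pole_fun_def prod_base_seq[OF that] by auto
  thus "mero_holomorphic_on r F (Cspace r)"
    by (intro mero_holomorphic_on_off_poles[OF G(2,1)]) (auto simp: pole_prod_eq)
next
  fix F m and idx :: "nat \<Rightarrow> nat"
  assume F: "meromorphic_continuation r f F"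
    and idx: "m \<ge> 1 \<and> strict_mono_on {1..m} idx \<and> idx ` {1..m} = {i\<in>{1..r}. partial_prod f i 1 = 1}"
  define b where "b = base_seq r f"
  obtain G where G: "separately_holo UNIV G"
    "generically r (Cspace r) (\<lambda>s. pole_prod r b (drop_arg s) * F s = G (drop_arg s))"
    using mult_L_continuation_generic[OF assms F] unfolding b_def by blast
  have in_range: "idx j \<in> {1..r}" "partial_prod f (idx j) 1 = 1" if "j \<in> {1..m}" for j
    using idx that by auto
  have count: "pole_count b (idx j - 1) = j" if "j \<in> {1..m}" for j
    using strict_mono_index_count[of m idx r "\<lambda>i. partial_prod f i 1 = 1" j] idx that in_range[OF that]
    unfolding b_def by (subst pole_count_base_seq) auto
  have prod1: "(\<Prod>l\<le>idx j - 1. b l) = 1" if "j \<in> {1..m}" for j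
    using in_range[OF that] unfolding b_def by (subst prod_base_seq) auto
  \<comment> \<open>The polar set as read off from the zeros of the denominator; both final claims
    reduce to rewriting it in terms of \<open>idx\<close>.\<close>
  define P where "P = {(Suc i, n) | i n. i < r \<and> (\<Prod>l\<le>i. b l) = 1 \<and>
      (i = 0 \<and> n = 1 \<or> i \<noteq> 0 \<and> n \<le> int (pole_count b i))}"
  have zeros: "pole_prod r b (drop_arg s) = 0 \<longleftrightarrow> s \<in> (\<Union>(i, n)\<in>P. hyperplane r i n)"
    if "s \<in> Cspace r" for s
  proof -
    have "s \<in> (\<Union>(i, n)\<in>P. hyperplane r i n) \<longleftrightarrow> (\<exists>i n. (i, n) \<in> P \<and> (\<Sum>j=1..i. s j) = of_int n)"
      using that by (auto simp: hyperplane_def partial_sum_form_def)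
    also have "\<dots> \<longleftrightarrow> (\<exists>i<r. \<exists>n. (\<Prod>l\<le>i. b l) = 1 \<and>
        (i = 0 \<and> n = 1 \<or> i \<noteq> 0 \<and> n \<le> int (pole_count b i)) \<and> (\<Sum>j\<le>i. drop_arg s j) = of_int n)"
      unfolding P_def sum_drop_arg by blast
    also have "\<dots> \<longleftrightarrow> (\<exists>i<r. pole_fun b i (\<Sum>j\<le>i. drop_arg s j) = 0)"
    proof -
      have "(\<exists>n. (\<Prod>l\<le>i. b l) = 1 \<and> (i = 0 \<and> n = 1 \<or> i \<noteq> 0 \<and> n \<le> int (pole_count b i)) \<and> z = of_int n)
          \<longleftrightarrow> pole_fun b i z = 0" for i z
        unfolding pole_fun_eq_0_iff by (cases "i = 0") auto
      thus ?thesis by simp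
    qed
    also have "\<dots> \<longleftrightarrow> pole_prod r b (drop_arg s) = 0"
      unfolding pole_prod_eq by (auto simp del: sum.atMost_Suc)
    finally show ?thesis by blast
  qed
  have main: "holomorphic_with_simple_poles r F P"
    unfolding holomorphic_with_simple_poles_def
  proof (intro conjI ballI)
    show "mero_holomorphic_on r F (Cspace r - (\<Union>(i, n)\<in>P. hyperplane r i n))"
      by (rule mero_holomorphic_on_off_poles[OF G(2,1)]) (use zeros in auto)
    show "case x of (i, n) \<Rightarrow> at_most_simple_pole_along r F i n" if "x \<in> P" for x
      using that unfolding P_def by (auto intro: simple_pole_along[OF G(2,1)])
  qed
  have P_iff: "(i, n) \<in> P \<longleftrightarrow> (\<exists>j\<in>{1..m}. i = idx j \<and> (i = 1 \<and> n = 1 \<or> i \<noteq> 1 \<and> n \<le> int j))" for i n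
  proof
    assume "(i, n) \<in> P"
    then obtain k where k: "i = Suc k" "k < r" "(\<Prod>l\<le>k. b l) = 1"
      "k = 0 \<and> n = 1 \<or> k \<noteq> 0 \<and> n \<le> int (pole_count b k)" unfolding P_def by blast
    have "i \<in> {i\<in>{1..r}. partial_prod f i 1 = 1}" using k unfolding b_def by (auto simp: prod_base_seq)
    then obtain j where j: "j \<in> {1..m}" "i = idx j" using idx by (metis imageE)
    have "k = idx j - 1" using k(1) j(2) by simp
    hence "pole_count b k = j" using count[OF j(1)] by simp
    thus "\<exists>j\<in>{1..m}. i = idx j \<and> (i = 1 \<and> n = 1 \<or> i \<noteq> 1 \<and> n \<le> int j)"
      using k j(2) by (intro bexI[OF _ j(1)]) auto
  next
    assume "\<exists>j\<in>{1..m}. i = idx j \<and> (i = 1 \<and> n = 1 \<or> i \<noteq> 1 \<and> n \<le> int j)"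
    then obtain j where j: "j \<in> {1..m}" "i = idx j" "i = 1 \<and> n = 1 \<or> i \<noteq> 1 \<and> n \<le> int j" by blast
    show "(i, n) \<in> P" unfolding P_def
      using j count[OF j(1)] prod1[OF j(1)] in_range[OF j(1)]
      by (intro CollectI exI[of _ "i - 1"] exI[of _ n]) auto
  qed
  have idx_gt: "idx 1 < idx j" if "2 \<le> j" "j \<le> m" for j
    using idx that by (intro strict_mono_onD[of "{1..m}" idx]) auto
  have idx_1: "1 \<le> idx 1" using in_range(1)[of 1] idx by auto
  show "holomorphic_with_simple_poles r F
      ({(1, 1)} \<union> {(idx j, n) | j n. 2 \<le> j \<and> j \<le> m \<and> n \<le> int j})" if one: "idx 1 = 1"
  proof -
    have "(i, n) \<in> P \<longleftrightarrow> (i, n) \<in> {(1, 1)} \<union> {(idx j, n) | j n. 2 \<le> j \<and> j \<le> m \<and> n \<le> int j}" for i n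
    proof
      assume "(i, n) \<in> P"
      then obtain j where j: "j \<in> {1..m}" "i = idx j" "i = 1 \<and> n = 1 \<or> i \<noteq> 1 \<and> n \<le> int j"
        unfolding P_iff by blast
      show "(i, n) \<in> {(1, 1)} \<union> {(idx j, n) | j n. 2 \<le> j \<and> j \<le> m \<and> n \<le> int j}"
        using j one by (cases "j = 1") force+
    next
      assume "(i, n) \<in> {(1, 1)} \<union> {(idx j, n) | j n. 2 \<le> j \<and> j \<le> m \<and> n \<le> int j}"
      then consider "i = 1" "n = 1" | j where "i = idx j" "2 \<le> j" "j \<le> m" "n \<le> int j" by auto
      thus "(i, n) \<in> P"
      proof cases
        case 1
        thus ?thesis unfolding P_iff using one idx by (intro bexI[of _ 1]) auto
      next
        case (2 j)
        thus ?thesis unfolding P_iff using one idx_gt[of j] by (intro bexI[of _ j]) auto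
      qed
    qed
    hence "P = {(1, 1)} \<union> {(idx j, n) | j n. 2 \<le> j \<and> j \<le> m \<and> n \<le> int j}" by (intro set_eqI) (simp only: split_paired_all)
    thus ?thesis using main by simp
  qed
  show "holomorphic_with_simple_poles r F {(idx j, n) | j n. 1 \<le> j \<and> j \<le> m \<and> n \<le> int j}"
    if "idx 1 \<noteq> 1"
  proof -
    \<comment> \<open>\<open>idx 1\<close> is the smallest pole index, so the exceptional linear
      factor of the first variable does not occur.\<close>
    have "idx j \<noteq> 1" if "j \<in> {1..m}" for j
      using idx_gt[of j] idx_1 \<open>idx 1 \<noteq> 1\<close> that by (cases "j = 1") auto
    hence "(i, n) \<in> P \<longleftrightarrow> (i, n) \<in> {(idx j, n) | j n. 1 \<le> j \<and> j \<le> m \<and> n \<le> int j}" for i n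
      unfolding P_iff by auto
    hence "P = {(idx j, n) | j n. 1 \<le> j \<and> j \<le> m \<and> n \<le> int j}" by (intro set_eqI) (simp only: split_paired_all)
    thus ?thesis using main by simp
  qed
qed

end
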